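(* Let $e=(e_n)$ denote the canonical basis of $\ell_p$, where $1<p<\infty$, and let $1\leq\xi\leq\omega_1$ be an ordinal. Then the class $\mathcal{WS}_{e,\xi}$ fails to be closed under addition (i.e. there exist Banach spaces $X$ and $Y$ and operators $S,T\in\mathcal{WS}_{e,\xi}(X,Y)$ with $S+T\notin\mathcal{WS}_{e,\xi}(X,Y)$), and hence $\mathcal{WS}_{e,\xi}$ is not an operator ideal.
   Context: Schreier families. For countable ordinals $0\leq\xi<\omega_1$, families $\mathcal{S}_\xi$ of finite subsets of $\mathbb{N}=\{1,2,\dots\}$ are defined recursively. $\mathcal{S}_0=\{\{n\}:n\in\mathbb{N}\}\cup\{\emptyset\}$. If $\xi=\zeta+1$, then $\mathcal{S}_\xi$ consists of $\emptyset$ together with all $F\subset\mathbb{N}$ for which there are $n\in\mathbb{N}$ and sets $F_1,\dots,F_n\in\mathcal{S}_\zeta$ with $F=\bigcup_{k=1}^nF_k$ and $n\leq F_1<\cdots<F_n$ (here $E<F$ means $\max E<\min F$ and $n\leq F$ means $n\leq\min F$). If $\xi$ is a limit ordinal, a strictly increasing sequence $(\zeta_n)$ of non-limit ordinals with $\sup_n\zeta_n=\xi$ is fixed and $\mathcal{S}_\xi=\bigcup_{n=1}^\infty\{F\in\mathcal{S}_{\zeta_n}:n\leq F\}$. By convention $\mathcal{S}_{\omega_1}$ denotes the family of all finite subsets of $\mathbb{N}$. Domination. For $1\leq\xi\leq\omega_1$, a sequence $(x_n)$ in a Banach space $\mathcal{S}_\xi$-dominates a sequence $(y_n)$ in a Banach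 space if there is $C\in[1,\infty)$ with $\|\sum_{n\in F}a_ny_n\|\leq C\|\sum_{n\in F}a_nx_n\|$ for all $(a_n)\in c_{00}$ and all $F\in\mathcal{S}_\xi$. Class $\mathcal{WS}_{e,\xi}$. Let $e=(e_n)$ be a normalized basis of a Banach space $E$ and $1\leq\xi\leq\omega_1$. For Banach spaces $X,Y$, $\mathcal{WS}_{e,\xi}(X,Y)$ is the set of all continuous linear operators $T\in\mathcal{L}(X,Y)$ such that for every normalized basic sequence $(x_n)$ in $X$, the sequence $(Tx_n)$ fails to $\mathcal{S}_\xi$-dominate $(e_n)$. The class $\mathcal{WS}_{e,\xi}$ is the union of these components over all $X,Y$. A class $\mathcal{J}$ of continuous linear operators between Banach spaces, with components $\mathcal{J}(X,Y)=\mathcal{J}\cap\mathcal{L}(X,Y)$, is an operator ideal if $BTA\in\mathcal{J}$ whenever $T\in\mathcal{J}(X,Y)$, $A\in\mathcal{L}(W,X)$, $B\in\mathcal{L}(Y,Z)$ for Banach spaces $W,X,Y,Z$, and every component is a linear subspace containing all finite-rank operators. It is closed under addition if every component is. *)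

theory Defs
  imports
    "HOL-Analysis.Analysis"
    "HOL-Algebra.Module"
    "HOL-Decision_Procs.Algebra_Aux"
begin

section \<open>Banach spaces\<close>

text \<open>
  The statement speaks about all Banach spaces at once, so a Banach space is a structure whose
  carrier is a set of elements of a universe type \<open>'u\<close>, not a type of class \<open>banach\<close>.
  The fields \<open>mult\<close> and \<open>one\<close> which the record inherits from \<open>module\<close> play no role.
  The scalars form a type \<open>'k\<close> of class \<open>{real_normed_field, heine_borel}\<close>; up to isometric
  isomorphism these are exactly the real and the complex numbers.
\<close>

record ('k, 'u) normed_module = "('k, 'u) module" +
  vnorm :: "'u \<Rightarrow> real"

text \<open>The value 0 off the carrier is forced by \<open>Metric_space\<close>, which requires a distance to be
  nonnegative and symmetric on the whole type.\<close>

definition ndist :: "('k, 'u) normed_module \<Rightarrow> 'u \<Rightarrow> 'u \<Rightarrow> real" where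
  "ndist X x y =
    (if x \<in> carrier X \<and> y \<in> carrier X then vnorm X (x \<ominus>\<^bsub>X\<^esub> y) else 0)"

abbreviation ntopology :: "('k, 'u) normed_module \<Rightarrow> 'u topology" where
  "ntopology X \<equiv> Metric_space.mtopology (carrier X) (ndist X)"

definition banach_space ::
    "('k::{real_normed_field, heine_borel}, 'u) normed_module \<Rightarrow> bool" where
  "banach_space X \<longleftrightarrow>
    Module.module cring_class_ops X \<and>
    (\<forall>x\<in>carrier X. 0 \<le> vnorm X x \<and> (vnorm X x = 0 \<longleftrightarrow> x = \<zero>\<^bsub>X\<^esub>)) \<and>
    (\<forall>x\<in>carrier X. \<forall>c. vnorm X (c \<odot>\<^bsub>X\<^esub> x) = norm c * vnorm X x) \<and>
    (\<forall>x\<in>carrier X. \<forall>y\<in>carrier X. vnorm X (x \<oplus>\<^bsub>X\<^esub> y) \<le> vnorm X x + vnorm X y) \<and>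
    Metric_space.mcomplete (carrier X) (ndist X)"

definition lin_span ::
    "('k::{real_normed_field, heine_borel}, 'u) normed_module \<Rightarrow> 'u set \<Rightarrow> 'u set" where
  "lin_span X B = {(\<Oplus>\<^bsub>X\<^esub>b\<in>F. c b \<odot>\<^bsub>X\<^esub> b) | c F. finite F \<and> F \<subseteq> B}"

text \<open>The index set of all sequences is \<open>{1, 2, ...}\<close>; the value at 0 is ignored.\<close>

definition series_converges_to ::
    "('k::{real_normed_field, heine_borel}, 'u) normed_module \<Rightarrow> (nat \<Rightarrow> 'k) \<Rightarrow> (nat \<Rightarrow> 'u) \<Rightarrow> 'u \<Rightarrow> bool"
  where
  "series_converges_to X a x y \<longleftrightarrow>
    limitin (ntopology X) (\<lambda>N. \<Oplus>\<^bsub>X\<^esub>n\<in>{1..N}. a n \<odot>\<^bsub>X\<^esub> x n) y sequentially"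

text \<open>\<open>x\<close> is a Schauder basis of the closed subspace \<open>V\<close> of \<open>X\<close>.\<close>

definition schauder_basis_on ::
    "('k::{real_normed_field, heine_borel}, 'u) normed_module \<Rightarrow> 'u set \<Rightarrow> (nat \<Rightarrow> 'u) \<Rightarrow> bool"
  where
  "schauder_basis_on X V x \<longleftrightarrow>
    (\<forall>n\<ge>1. x n \<in> V) \<and>
    (\<forall>y\<in>V. \<exists>a. series_converges_to X a x y \<and>
       (\<forall>b. series_converges_to X b x y \<longrightarrow> (\<forall>n\<ge>1. b n = a n)))"

definition basic_sequence ::
    "('k::{real_normed_field, heine_borel}, 'u) normed_module \<Rightarrow> (nat \<Rightarrow> 'u) \<Rightarrow> bool" where
  "basic_sequence X x \<longleftrightarrow>
    (\<forall>n\<ge>1. x n \<in> carrier X) \<and>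
    schauder_basis_on X (ntopology X closure_of lin_span X (x ` {1..})) x"

definition normalized :: "('k, 'u) normed_module \<Rightarrow> (nat \<Rightarrow> 'u) \<Rightarrow> bool" where
  "normalized X x \<longleftrightarrow> (\<forall>n\<ge>1. vnorm X (x n) = 1)"


section \<open>Operators and classes of operators\<close>

text \<open>Operators are extensional functions, so that an operator on \<open>X\<close> is determined by its
  values on \<open>carrier X\<close>.\<close>

definition operators ::
    "('k::{real_normed_field, heine_borel}, 'u) normed_module \<Rightarrow> ('k, 'v) normed_module \<Rightarrow> ('u \<Rightarrow> 'v) set"
  where
  "operators X Y = {T. T \<in> carrier X \<rightarrow>\<^sub>E carrier Y \<and>
    (\<forall>x\<in>carrier X. \<forall>y\<in>carrier X. T (x \<oplus>\<^bsub>X\<^esub> y) = T x \<oplus>\<^bsub>Y\<^esub> T y) \<and>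
    (\<forall>c. \<forall>x\<in>carrier X. T (c \<odot>\<^bsub>X\<^esub> x) = c \<odot>\<^bsub>Y\<^esub> T x) \<and>
    continuous_map (ntopology X) (ntopology Y) T}"

definition op_add ::
    "('k, 'u) normed_module \<Rightarrow> ('k, 'v) normed_module \<Rightarrow> ('u \<Rightarrow> 'v) \<Rightarrow> ('u \<Rightarrow> 'v) \<Rightarrow> 'u \<Rightarrow> 'v" where
  "op_add X Y S T = (\<lambda>x\<in>carrier X. S x \<oplus>\<^bsub>Y\<^esub> T x)"

definition op_scale ::
    "('k, 'u) normed_module \<Rightarrow> ('k, 'v) normed_module \<Rightarrow> 'k \<Rightarrow> ('u \<Rightarrow> 'v) \<Rightarrow> 'u \<Rightarrow> 'v" where
  "op_scale X Y c T = (\<lambda>x\<in>carrier X. c \<odot>\<^bsub>Y\<^esub> T x)"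

definition finite_rank ::
    "('k::{real_normed_field, heine_borel}, 'u) normed_module \<Rightarrow> ('k, 'v) normed_module \<Rightarrow> ('u \<Rightarrow> 'v) \<Rightarrow> bool"
  where
  "finite_rank X Y T \<longleftrightarrow>
    (\<exists>B. finite B \<and> B \<subseteq> carrier Y \<and> T ` carrier X \<subseteq> lin_span Y B)"

text \<open>An operator carries its domain and codomain: \<open>(X, Y, T)\<close> stands for \<open>T : X \<rightarrow> Y\<close>.\<close>

type_synonym ('k, 'u) op_class =
  "(('k, 'u) normed_module \<times> ('k, 'u) normed_module \<times> ('u \<Rightarrow> 'u)) set"

definition component ::
    "('k, 'u) op_class \<Rightarrow> ('k, 'u) normed_module \<Rightarrow> ('k, 'u) normed_module \<Rightarrow> ('u \<Rightarrow> 'u) set" where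
  "component J X Y = {T. (X, Y, T) \<in> J}"

definition operator_class :: "('k::{real_normed_field, heine_borel}, 'u) op_class \<Rightarrow> bool" where
  "operator_class J \<longleftrightarrow>
    (\<forall>(X, Y, T)\<in>J. banach_space X \<and> banach_space Y \<and> T \<in> operators X Y)"

definition closed_under_addition :: "('k::{real_normed_field, heine_borel}, 'u) op_class \<Rightarrow> bool" where
  "closed_under_addition J \<longleftrightarrow>
    (\<forall>X Y. banach_space X \<longrightarrow> banach_space Y \<longrightarrow>
      (\<forall>S\<in>component J X Y. \<forall>T\<in>component J X Y. op_add X Y S T \<in> component J X Y))"

definition operator_ideal :: "('k::{real_normed_field, heine_borel}, 'u) op_class \<Rightarrow> bool" where
  "operator_ideal J \<longleftrightarrow>
    operator_class J \<and>
    (\<forall>W X Y Z. banach_space W \<longrightarrow> banach_space X \<longrightarrow> banach_space Y \<longrightarrow> banach_space Z \<longrightarrow>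
      (\<forall>A\<in>operators W X. \<forall>T\<in>component J X Y. \<forall>B\<in>operators Y Z.
        compose (carrier W) B (compose (carrier W) T A) \<in> component J W Z)) \<and>
    (\<forall>X Y. banach_space X \<longrightarrow> banach_space Y \<longrightarrow>
      (\<forall>T\<in>operators X Y. finite_rank X Y T \<longrightarrow> T \<in> component J X Y) \<and>
      (\<forall>S\<in>component J X Y. \<forall>T\<in>component J X Y. op_add X Y S T \<in> component J X Y) \<and>
      (\<forall>c. \<forall>T\<in>component J X Y. op_scale X Y c T \<in> component J X Y))"


section \<open>Schreier families\<close>

text \<open>
  An ordinal is an element \<open>\<xi>\<close> of an arbitrary well-ordered type and stands for the order type
  of \<open>{..<\<xi>}\<close>. So \<open>\<xi>\<close> is 0 iff \<open>{..<\<xi>} = {}\<close>, it is \<open>\<zeta> + 1\<close> iff \<open>{..<\<xi>} = {..\<zeta>}\<close>, it is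
  countable iff \<open>{..<\<xi>}\<close> is, and it is at most \<open>\<omega>\<^sub>1\<close> iff all \<open>\<eta> < \<xi>\<close> are countable.
\<close>

definition limit_ordinal :: "'o::wellorder \<Rightarrow> bool" where
  "limit_ordinal \<xi> \<longleftrightarrow> {..<\<xi>} \<noteq> {} \<and> (\<nexists>\<zeta>. {..<\<xi>} = {..\<zeta>})"

text \<open>A choice, for every countable limit ordinal \<open>\<xi>\<close>, of a strictly increasing sequence
  \<open>L \<xi> 1, L \<xi> 2, ...\<close> of non-limit ordinals with supremum \<open>\<xi>\<close>.\<close>

definition ladder_system :: "('o::wellorder \<Rightarrow> nat \<Rightarrow> 'o) \<Rightarrow> bool" where
  "ladder_system L \<longleftrightarrow>
    (\<forall>\<xi>. limit_ordinal \<xi> \<longrightarrow> countable {..<\<xi>} \<longrightarrow>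
      strict_mono_on {1..} (L \<xi>) \<and>
      (\<forall>n\<ge>1. \<not> limit_ordinal (L \<xi> n)) \<and>
      (\<forall>\<eta>. (\<forall>n\<ge>1. L \<xi> n \<le> \<eta>) \<longleftrightarrow> \<xi> \<le> \<eta>))"

text \<open>The recursion defining \<open>S\<^sub>\<xi>\<close> for countable \<open>\<xi>\<close>. The sets \<open>G 1 < ... < G n\<close> in the successor
  step are nonempty, so that \<open>Min\<close> and \<open>Max\<close> are meaningful.\<close>

inductive schreier :: "('o::wellorder \<Rightarrow> nat \<Rightarrow> 'o) \<Rightarrow> 'o \<Rightarrow> nat set \<Rightarrow> bool"
  for L :: "'o \<Rightarrow> nat \<Rightarrow> 'o" where
  empty: "schreier L \<xi> {}"
| zero: "{..<\<xi>} = {} \<Longrightarrow> n \<ge> 1 \<Longrightarrow> schreier L \<xi> {n}"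
| succ: "{..<\<xi>} = {..\<zeta>} \<Longrightarrow> n \<ge> 1 \<Longrightarrow>
    (\<And>k. k \<in> {1..n} \<Longrightarrow> schreier L \<zeta> (G k)) \<Longrightarrow>
    (\<And>k. k \<in> {1..n} \<Longrightarrow> G k \<noteq> {}) \<Longrightarrow>
    n \<le> Min (G 1) \<Longrightarrow>
    (\<And>k. k \<in> {1..<n} \<Longrightarrow> Max (G k) < Min (G (Suc k))) \<Longrightarrow>
    schreier L \<xi> (\<Union>k\<in>{1..n}. G k)"
| limit: "limit_ordinal \<xi> \<Longrightarrow> n \<ge> 1 \<Longrightarrow> schreier L (L \<xi> n) F \<Longrightarrow> (\<forall>m\<in>F. n \<le> m) \<Longrightarrow>
    schreier L \<xi> F"

definition schreier_family :: "('o::wellorder \<Rightarrow> nat \<Rightarrow> 'o) \<Rightarrow> 'o \<Rightarrow> nat set set" where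
  "schreier_family L \<xi> =
    (if countable {..<\<xi>} then {F. schreier L \<xi> F} else {F. finite F \<and> F \<subseteq> {1..}})"


section \<open>Domination and the class WS\<close>

text \<open>\<open>x\<close> in \<open>X\<close> dominates \<open>y\<close> in \<open>Y\<close> with respect to the family \<open>\<F>\<close> of subsets of \<open>{1, 2, ...}\<close>.\<close>

definition dominates ::
    "nat set set \<Rightarrow> ('k::{real_normed_field, heine_borel}, 'u) normed_module \<Rightarrow> (nat \<Rightarrow> 'u) \<Rightarrow>
      ('k, 'v) normed_module \<Rightarrow> (nat \<Rightarrow> 'v) \<Rightarrow> bool" where
  "dominates \<F> X x Y y \<longleftrightarrow>
    (\<exists>C::real. C \<ge> 1 \<and>
      (\<forall>a. finite {n. a n \<noteq> 0} \<longrightarrow> (\<forall>F\<in>\<F>.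
        vnorm Y (\<Oplus>\<^bsub>Y\<^esub>n\<in>F. a n \<odot>\<^bsub>Y\<^esub> y n) \<le> C * vnorm X (\<Oplus>\<^bsub>X\<^esub>n\<in>F. a n \<odot>\<^bsub>X\<^esub> x n))))"

definition WS ::
    "('k::{real_normed_field, heine_borel}, 'e) normed_module \<Rightarrow> (nat \<Rightarrow> 'e) \<Rightarrow>
      ('o::wellorder \<Rightarrow> nat \<Rightarrow> 'o) \<Rightarrow> 'o \<Rightarrow> ('k, 'u) op_class" where
  "WS E e L \<xi> = {(X, Y, T). banach_space X \<and> banach_space Y \<and> T \<in> operators X Y \<and>
    (\<forall>x. basic_sequence X x \<longrightarrow> normalized X x \<longrightarrow>
      \<not> dominates (schreier_family L \<xi>) Y (\<lambda>n. T (x n)) E e)}"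


section \<open>The sequence space of exponent p\<close>

text \<open>Coordinates are indexed by \<open>{1, 2, ...}\<close>, hence the condition \<open>f 0 = 0\<close>.\<close>

definition lp_space :: "real \<Rightarrow> ('k::{real_normed_field, heine_borel}, nat \<Rightarrow> 'k) normed_module" where
  "lp_space p =
    \<lparr>carrier = {f. f 0 = 0 \<and> summable (\<lambda>n. norm (f n) powr p)},
     mult = undefined, one = undefined,
     zero = (\<lambda>n. 0), add = (\<lambda>f g n. f n + g n), smult = (\<lambda>c f n. c * f n),
     vnorm = (\<lambda>f. (\<Sum>n. norm (f n) powr p) powr (1 / p))\<rparr>"

definition unit_vector :: "nat \<Rightarrow> nat \<Rightarrow> 'k::{real_normed_field, heine_borel}" where
  "unit_vector n = (\<lambda>m. if m = n then 1 else 0)"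

end

theory Submission
  imports Defs
begin

text \<open>
  Take \<open>X = \<ell>\<^sub>1\<close> and let \<open>Y\<close> be a sequence space normed by \<open>a \<mapsto> sup \<Sum>\<^sub>i w\<^sub>i \<bar>a\<^sub>i\<bar>\<close>, where \<open>w\<close> ranges over
  finitely supported weights of \<open>\<ell>\<^sub>q\<close>-norm at most 1 (\<open>q\<close> conjugate to \<open>p\<close>). Cut the possible values
  of a weight into rapidly decreasing levels, and let \<open>w\<^sub>i\<close> take values only in levels of the same
  parity as \<open>i\<close>. The operators place a sequence on the even and on the odd coordinates of \<open>Y\<close>. Every
  extremal functional of \<open>\<ell>\<^sub>p\<close> splits into an even and an odd admissible part, so the sum of the two
  operators maps the unit vectors of \<open>\<ell>\<^sub>1\<close> to a sequence dominating the basis of \<open>\<ell>\<^sub>p\<close>. A single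
  operator lacks every second level: if \<open>n\<^bsup>-1/q\<^esup>\<close> lies in a missing level, then \<open>n\<close> coordinates
  carry total weight much less than \<open>n\<^bsup>1/p\<^esup>\<close>. By a gliding hump argument any bounded sequence in
  \<open>\<ell>\<^sub>1\<close> has almost disjoint differences, far enough out for their indices to form a Schreier set,
  and the sum of \<open>n\<close> such differences then has norm much smaller than \<open>n\<^bsup>1/p\<^esup>\<close>.
\<close>

section \<open>Weighted sequence spaces\<close>

text \<open>Every weight in use has finite support, so this is a finite sum and no convergence
  question arises.\<close>

definition pairing :: "(nat \<Rightarrow> real) \<Rightarrow> (nat \<Rightarrow> 'k::real_normed_field) \<Rightarrow> real" where
  "pairing w a = (\<Sum>i | w i \<noteq> 0. w i * norm (a i))"

definition koethe_seqs :: "(nat \<Rightarrow> real) set \<Rightarrow> (nat \<Rightarrow> 'k::real_normed_field) set" where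
  "koethe_seqs W = {a. bdd_above ((\<lambda>w. pairing w a) ` W)}"

definition koethe_norm :: "(nat \<Rightarrow> real) set \<Rightarrow> (nat \<Rightarrow> 'k::real_normed_field) \<Rightarrow> real" where
  "koethe_norm W a = (SUP w\<in>W. pairing w a)"

text \<open>The sequences are transported into the universe type \<open>'u\<close> along
  \<open>j\<close>, because a class of operators has its domains and codomains over one common type.
  The operations are meaningful when \<open>j\<close> is injective, which
  \<open>weight_family\<close> assumes.\<close>

definition koethe_space ::
    "(nat \<Rightarrow> real) set \<Rightarrow> ((nat \<Rightarrow> 'k::real_normed_field) \<Rightarrow> 'u) \<Rightarrow> ('k, 'u) normed_module" where
  "koethe_space W j =
    \<lparr>carrier = j ` koethe_seqs W, mult = undefined, one = undefined,
     zero = j (\<lambda>i. 0), add = (\<lambda>x y. j (\<lambda>i. the_inv j x i + the_inv j y i)),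
     smult = (\<lambda>c x. j (\<lambda>i. c * the_inv j x i)),
     vnorm = (\<lambda>x. koethe_norm W (the_inv j x))\<rparr>"

text \<open>The supremum of the pairings over these weights is the
  \<open>\<ell>\<^sub>1\<close>-norm, so this family yields a copy of
  \<open>\<ell>\<^sub>1\<close>.\<close>

definition unit_weights :: "(nat \<Rightarrow> real) set" where
  "unit_weights = {w. finite {i. w i \<noteq> 0} \<and> (\<forall>i. 0 \<le> w i \<and> w i \<le> 1)}"

lemma pairing_eq_sum:
  assumes "finite G" "{i. w i \<noteq> 0} \<subseteq> G"
  shows "pairing w a = (\<Sum>i\<in>G. w i * norm (a i))"
  unfolding pairing_def by (rule sum.mono_neutral_left) (use assms in auto)

lemma pairing_scale: "pairing w (\<lambda>i. c * a i) = norm c * pairing w a"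
  unfolding pairing_def by (simp add: norm_mult sum_distrib_left mult_ac)

text \<open>By \<open>W_vec\<close> the norm controls every coordinate, which gives definiteness and
  coordinatewise limits. By \<open>W_unit\<close> pairings are finite sums and unit vectors have
  norm at most 1. Together they make the unit vectors normalized.\<close>

locale weight_family =
  fixes W :: "(nat \<Rightarrow> real) set" and j :: "(nat \<Rightarrow> 'k::{real_normed_field, heine_borel}) \<Rightarrow> 'u"
  assumes inj_j: "inj j"
    and W_unit: "W \<subseteq> unit_weights"
    and W_vec: "(\<lambda>m. if m = i then 1 else 0) \<in> W"
begin

abbreviation X where "X \<equiv> koethe_space W j"

lemma the_inv_j [simp]: "the_inv j (j a) = a"
  using inj_j by (rule the_inv_f_f)

lemma W_finite: "w \<in> W \<Longrightarrow> finite {i. w i \<noteq> 0}"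
  and W_nonneg: "w \<in> W \<Longrightarrow> 0 \<le> w i" and W_le1: "w \<in> W \<Longrightarrow> w i \<le> 1"
  using W_unit by (auto simp: unit_weights_def)

section \<open>Norm estimates for sequences\<close>

lemma pairing_mono:
  assumes "w \<in> W" "\<And>i. norm (a i) \<le> norm (b i)"
  shows "pairing w a \<le> pairing w b"
  unfolding pairing_def by (intro sum_mono mult_left_mono assms W_nonneg)

lemma pairing_add:
  assumes "w \<in> W" shows "pairing w (\<lambda>i. a i + b i) \<le> pairing w a + pairing w b"
  unfolding pairing_def sum.distrib[symmetric] distrib_left[symmetric]
  by (intro sum_mono mult_left_mono norm_triangle_ineq W_nonneg assms)

lemma pairing_le_norm:
  assumes "a \<in> koethe_seqs W" "w \<in> W" shows "pairing w a \<le> koethe_norm W a"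
  unfolding koethe_norm_def by (rule cSUP_upper) (use assms in \<open>auto simp: koethe_seqs_def\<close>)

lemma W_ne: "W \<noteq> {}" using W_vec by blast

lemma norm_le:
  assumes "\<And>w. w \<in> W \<Longrightarrow> pairing w a \<le> B"
  shows "koethe_norm W a \<le> B"
  unfolding koethe_norm_def by (rule cSUP_least[OF W_ne]) (use assms in auto)

lemma seqsI:
  assumes "\<And>w. w \<in> W \<Longrightarrow> pairing w a \<le> B" shows "a \<in> koethe_seqs W"
  unfolding koethe_seqs_def mem_Collect_eq using assms by (rule bdd_aboveI2)

lemma coord_le:
  assumes "a \<in> koethe_seqs W" shows "norm (a i) \<le> koethe_norm W a"
  using pairing_le_norm[OF assms W_vec[of i]] pairing_eq_sum[of "{i}" "\<lambda>m. if m = i then 1 else 0" a] by simp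

lemma norm_nonneg: "a \<in> koethe_seqs W \<Longrightarrow> 0 \<le> koethe_norm W a"
  using coord_le[of a 0] norm_ge_zero order_trans by blast

lemma seqs_zero: "(\<lambda>i. 0) \<in> koethe_seqs W"
  by (rule seqsI[of _ 0]) (simp add: pairing_def)

lemma norm_zero: "koethe_norm W (\<lambda>i. 0) = 0"
  using norm_nonneg[OF seqs_zero] by (intro antisym norm_le) (simp_all add: pairing_def)

lemma norm_eq_0_iff: "a \<in> koethe_seqs W \<Longrightarrow> koethe_norm W a = 0 \<longleftrightarrow> a = (\<lambda>i. 0)"
  using coord_le[of a] norm_zero by fastforce

text \<open>The norm is a lattice norm: it sees only absolute values and is monotone in them. In
  particular truncating a sequence never increases its norm.\<close>

lemma seqs_mono:
  assumes "b \<in> koethe_seqs W" "\<And>i. norm (a i) \<le> norm (b i)"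
  shows "a \<in> koethe_seqs W" and "koethe_norm W a \<le> koethe_norm W b"
proof -
  have "pairing w a \<le> koethe_norm W b" if "w \<in> W" for w
    using pairing_mono[of w a b, OF that assms(2)] pairing_le_norm[OF assms(1) that] by simp
  then show "a \<in> koethe_seqs W" "koethe_norm W a \<le> koethe_norm W b"
    by (auto intro: seqsI norm_le)
qed

lemma seqs_add:
  assumes "a \<in> koethe_seqs W" "b \<in> koethe_seqs W"
  shows "(\<lambda>i. a i + b i) \<in> koethe_seqs W"
    and "koethe_norm W (\<lambda>i. a i + b i) \<le> koethe_norm W a + koethe_norm W b"
proof -
  have "pairing w (\<lambda>i. a i + b i) \<le> koethe_norm W a + koethe_norm W b" if "w \<in> W" for w
    using pairing_add[OF that, of a b] pairing_le_norm[OF assms(1) that] pairing_le_norm[OF assms(2) that]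
    by linarith
  then show "(\<lambda>i. a i + b i) \<in> koethe_seqs W"
    "koethe_norm W (\<lambda>i. a i + b i) \<le> koethe_norm W a + koethe_norm W b"
    by (auto intro: seqsI norm_le)
qed

lemma seqs_scale:
  assumes "a \<in> koethe_seqs W"
  shows "(\<lambda>i. c * a i) \<in> koethe_seqs W"
    and "koethe_norm W (\<lambda>i. c * a i) = norm c * koethe_norm W a"
proof -
  have le: "(\<lambda>i. c * a i) \<in> koethe_seqs W \<and> koethe_norm W (\<lambda>i. c * a i) \<le> norm c * koethe_norm W a"
    if "a \<in> koethe_seqs W" for c a
  proof -
    have "pairing w (\<lambda>i. c * a i) \<le> norm c * koethe_norm W a" if "w \<in> W" for w
      unfolding pairing_scale using pairing_le_norm[OF \<open>a \<in> koethe_seqs W\<close> that] by (simp add: mult_left_mono)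
    then show ?thesis by (auto intro: seqsI norm_le)
  qed
  show 1: "(\<lambda>i. c * a i) \<in> koethe_seqs W" using le[OF assms] by simp
  show "koethe_norm W (\<lambda>i. c * a i) = norm c * koethe_norm W a"
  proof (cases "c = 0")
    case True then show ?thesis by (simp add: norm_zero)
  next
    case False
    \<comment> \<open>The reverse inequality is the first one applied to the scalar
      \<open>inverse c\<close> and the sequence already multiplied by \<open>c\<close>.\<close>
    have "koethe_norm W a \<le> norm (inverse c) * koethe_norm W (\<lambda>i. c * a i)"
      using le[OF 1, of "inverse c"] False by (simp add: mult.assoc[symmetric])
    then have "norm c * koethe_norm W a \<le> koethe_norm W (\<lambda>i. c * a i)"
      using False by (simp add: norm_inverse norm_divide field_simps)
    then show ?thesis using le[OF assms, of c] by simp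
  qed
qed

lemma seqs_uminus: "a \<in> koethe_seqs W \<Longrightarrow> (\<lambda>i. - a i) \<in> koethe_seqs W"
  using seqs_scale(1)[of a "-1"] by simp

lemma seqs_diff:
  assumes "a \<in> koethe_seqs W" "b \<in> koethe_seqs W" shows "(\<lambda>i. a i - b i) \<in> koethe_seqs W"
  using seqs_add(1)[OF assms(1) seqs_uminus[OF assms(2)]] by simp

lemma norm_diff_commute: "koethe_norm W (\<lambda>i. a i - b i) = koethe_norm W (\<lambda>i. b i - a i)"
  unfolding koethe_norm_def pairing_def by (simp add: norm_minus_commute)

lemma seqs_finite_support:
  assumes "finite G" "\<And>i. i \<notin> G \<Longrightarrow> a i = 0"
  shows "a \<in> koethe_seqs W"
proof (rule seqsI)
  fix w assume w: "w \<in> W"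
  have "pairing w a = (\<Sum>i\<in>G \<union> {i. w i \<noteq> 0}. w i * norm (a i))"
    by (rule pairing_eq_sum) (use assms W_finite[OF w] in auto)
  also have "\<dots> = (\<Sum>i\<in>G. w i * norm (a i))"
    by (rule sum.mono_neutral_right) (use assms W_finite[OF w] in auto)
  also have "\<dots> \<le> (\<Sum>i\<in>G. norm (a i))"
    by (intro sum_mono mult_left_le_one_le[OF norm_ge_zero] W_nonneg W_le1 w)
  finally show "pairing w a \<le> (\<Sum>i\<in>G. norm (a i))" .
qed

section \<open>The Banach space structure\<close>

lemma carrier_X [simp]: "carrier X = j ` koethe_seqs W"
  and zero_X [simp]: "\<zero>\<^bsub>X\<^esub> = j (\<lambda>i. 0)"
  and add_X [simp]: "j a \<oplus>\<^bsub>X\<^esub> j b = j (\<lambda>i. a i + b i)"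
  and smult_X [simp]: "c \<odot>\<^bsub>X\<^esub> j a = j (\<lambda>i. c * a i)"
  and vnorm_X [simp]: "vnorm X (j a) = koethe_norm W a"
  by (simp_all add: koethe_space_def)

lemma abelian_group_X: "abelian_group X"
proof (rule abelian_groupI)
  fix x assume "x \<in> carrier X"
  then obtain a where a: "x = j a" "a \<in> koethe_seqs W" by auto
  then show "\<exists>y\<in>carrier X. y \<oplus>\<^bsub>X\<^esub> x = \<zero>\<^bsub>X\<^esub>"
    using seqs_uminus[of a] by (intro bexI[of _ "j (\<lambda>i. - a i)"]) auto
qed (auto simp: seqs_add(1) seqs_zero add_ac)

sublocale X: abelian_group X by (rule abelian_group_X)

lemma module_X: "Module.module cring_class_ops X"
  by (rule moduleI[OF cring_class abelian_group_X])
    (auto simp: seqs_scale(1) class_simps algebra_simps)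

lemma minus_X [simp]:
  assumes "a \<in> koethe_seqs W" "b \<in> koethe_seqs W"
  shows "j a \<ominus>\<^bsub>X\<^esub> j b = j (\<lambda>i. a i - b i)"
proof -
  have "\<ominus>\<^bsub>X\<^esub> j b = j (\<lambda>i. - b i)"
    by (rule X.minus_equality) (use assms seqs_uminus in auto)
  then show ?thesis by (simp add: a_minus_def)
qed

lemma ndist_X [simp]:
  assumes "a \<in> koethe_seqs W" "b \<in> koethe_seqs W"
  shows "ndist X (j a) (j b) = koethe_norm W (\<lambda>i. a i - b i)"
  using assms by (simp add: ndist_def)

lemma finsum_X:
  assumes "\<And>n. n \<in> F \<Longrightarrow> f n \<in> koethe_seqs W"
  shows "(\<Oplus>\<^bsub>X\<^esub>n\<in>F. j (f n)) = j (\<lambda>i. \<Sum>n\<in>F. f n i)"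
proof -
  have "(\<Oplus>\<^bsub>X\<^esub>n\<in>F. j (f n)) = j (\<lambda>i. \<Sum>n\<in>F. f n i) \<and> (\<lambda>i. \<Sum>n\<in>F. f n i) \<in> koethe_seqs W"
    using assms
  proof (induction F rule: infinite_finite_induct)
    case (insert n F)
    then show ?case by (subst X.finsum_insert) (auto simp: seqs_add(1))
  qed (auto simp: seqs_zero)
  then show ?thesis ..
qed

lemma finsum_smult_X:
  assumes "\<And>n. n \<in> F \<Longrightarrow> f n \<in> koethe_seqs W"
  shows "(\<Oplus>\<^bsub>X\<^esub>n\<in>F. a n \<odot>\<^bsub>X\<^esub> j (f n)) = j (\<lambda>i. \<Sum>n\<in>F. a n * f n i)"
  using finsum_X[of F "\<lambda>n i. a n * f n i"] seqs_scale(1)[OF assms] by simp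

lemma Metric_X: "Metric_space (carrier X) (ndist X)"
proof
  show "0 \<le> ndist X x y" for x y
    by (auto simp: ndist_def intro!: norm_nonneg seqs_diff)
  show "ndist X x y = ndist X y x" for x y
    by (auto simp: ndist_def intro: norm_diff_commute)
next
  fix x y assume "x \<in> carrier X" "y \<in> carrier X"
  then obtain a b where ab: "x = j a" "y = j b" "a \<in> koethe_seqs W" "b \<in> koethe_seqs W" by auto
  then show "ndist X x y = 0 \<longleftrightarrow> x = y"
    using norm_eq_0_iff[OF seqs_diff[of a b]] by (auto simp: fun_eq_iff inj_eq[OF inj_j])
next
  fix x y z assume "x \<in> carrier X" "y \<in> carrier X" "z \<in> carrier X"
  then obtain a b c where ab: "x = j a" "y = j b" "z = j c" "a \<in> koethe_seqs W" "b \<in> koethe_seqs W" "c \<in> koethe_seqs W"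
    by auto
  then show "ndist X x z \<le> ndist X x y + ndist X y z"
    using seqs_add(2)[OF seqs_diff[of a b] seqs_diff[of b c]] by simp
qed

sublocale M: Metric_space "carrier X" "ndist X" by (rule Metric_X)

text \<open>A Cauchy sequence converges in each coordinate. A pairing involves finitely many
  coordinates, so a bound on pairings survives the coordinatewise limit, which is therefore also the
  limit in norm.\<close>

lemma mcomplete_X: "M.mcomplete"
  unfolding M.mcomplete_def
proof (intro allI impI)
  fix s assume "M.MCauchy s"
  note s_cau = this[unfolded M.MCauchy_def]
  from s_cau have rs: "range s \<subseteq> j ` koethe_seqs W" by simp
  from s_cau have cau: "\<And>e. e > 0 \<Longrightarrow> \<exists>N. \<forall>n n'. N \<le> n \<longrightarrow> N \<le> n' \<longrightarrow> ndist X (s n) (s n') < e"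
    by blast
  from rs have "\<forall>n. \<exists>a. a \<in> koethe_seqs W \<and> s n = j a" by blast
  then obtain a where a: "\<And>n. a n \<in> koethe_seqs W" and s: "\<And>n. s n = j (a n)" by metis
  have "Cauchy (\<lambda>n. a n i)" for i
    unfolding Cauchy_def
  proof (intro allI impI)
    fix e :: real assume "e > 0"
    from cau[OF this] obtain N where
      N: "\<And>n n'. N \<le> n \<Longrightarrow> N \<le> n' \<Longrightarrow> koethe_norm W (\<lambda>i. a n i - a n' i) < e"
      by (auto simp: s a)
    have "dist (a m i) (a n i) < e" if "m \<ge> N" "n \<ge> N" for m n
      using N[OF that] coord_le[OF seqs_diff[OF a[of m] a[of n]], of i] by (simp add: dist_norm)
    then show "\<exists>M. \<forall>m\<ge>M. \<forall>n\<ge>M. dist (a m i) (a n i) < e" by blast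
  qed
  then have "\<forall>i. \<exists>l. (\<lambda>n. a n i) \<longlonglongrightarrow> l"
    by (simp add: Cauchy_convergent_iff convergent_def)
  then obtain b where b: "\<And>i. (\<lambda>n. a n i) \<longlonglongrightarrow> b i"
    using choice[of "\<lambda>i l. (\<lambda>n. a n i) \<longlonglongrightarrow> l"] by blast
  \<comment> \<open>\<open>N\<close> does not depend on \<open>w\<close>, so the supremum over
    \<open>W\<close> may be taken afterwards.\<close>
  have key: "\<exists>N. \<forall>n\<ge>N. \<forall>w\<in>W. pairing w (\<lambda>i. a n i - b i) \<le> e" if "e > 0" for e
  proof -
    from cau[OF that] obtain N where
      N: "\<And>n n'. N \<le> n \<Longrightarrow> N \<le> n' \<Longrightarrow> koethe_norm W (\<lambda>i. a n i - a n' i) < e"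
      by (auto simp: s a)
    have "pairing w (\<lambda>i. a n i - b i) \<le> e" if "n \<ge> N" "w \<in> W" for n w
    proof (rule tendsto_upperbound)
      show "(\<lambda>m. pairing w (\<lambda>i. a n i - a m i)) \<longlonglongrightarrow> pairing w (\<lambda>i. a n i - b i)"
        unfolding pairing_def by (intro tendsto_intros b)
      have "pairing w (\<lambda>i. a n i - a m i) \<le> e" if "m \<ge> N" for m
        using pairing_le_norm[OF seqs_diff[OF a a] \<open>w \<in> W\<close>, of n m] N[OF \<open>n \<ge> N\<close> that] by linarith
      then show "\<forall>\<^sub>F m in sequentially. pairing w (\<lambda>i. a n i - a m i) \<le> e"
        by (auto simp: eventually_sequentially)
    qed auto
    then show ?thesis by blast
  qed
  obtain N where "\<forall>n\<ge>N. \<forall>w\<in>W. pairing w (\<lambda>i. a n i - b i) \<le> 1" using key[of 1] by auto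
  then have "(\<lambda>i. a N i - b i) \<in> koethe_seqs W" by (auto intro: seqsI)
  \<comment> \<open>The limit is recovered as \<open>b = a N - (a N - b)\<close>.\<close>
  from seqs_diff[OF a[of N] this] have bW: "b \<in> koethe_seqs W" by simp
  have "limitin M.mtopology s (j b) sequentially"
    unfolding M.limit_metric_sequentially
  proof (intro conjI allI impI)
    fix e :: real assume "e > 0"
    then obtain N where N: "\<forall>n\<ge>N. \<forall>w\<in>W. pairing w (\<lambda>i. a n i - b i) \<le> e / 2" using key[of "e/2"] by auto
    have "s n \<in> carrier X \<and> ndist X (s n) (j b) < e" if "n \<ge> N" for n
    proof -
      have "koethe_norm W (\<lambda>i. a n i - b i) \<le> e / 2" using N that by (intro norm_le) auto
      then show ?thesis using \<open>e > 0\<close> by (simp add: s a bW)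
    qed
    then show "\<exists>N. \<forall>n\<ge>N. s n \<in> carrier X \<and> ndist X (s n) (j b) < e" by blast
  qed (simp add: bW)
  then show "\<exists>x. limitin M.mtopology s x sequentially" ..
qed

lemma banach_X: "banach_space X"
  unfolding banach_space_def
  using module_X mcomplete_X
  by (auto simp: norm_nonneg norm_eq_0_iff inj_eq[OF inj_j] seqs_scale(2) seqs_add(2))

section \<open>The unit vectors as a normalized basic sequence\<close>

lemma unit_vector_seqs: "(unit_vector n :: nat \<Rightarrow> 'k) \<in> koethe_seqs W"
  by (rule seqs_finite_support[of "{n}"]) (auto simp: unit_vector_def)

lemma unit_vector_sum:
  assumes "finite F"
  shows "(\<Sum>n\<in>F. c n * unit_vector n i) = (if i \<in> F then c i else 0)"
  using assms by (simp add: unit_vector_def if_distrib[of "(*) _"] cong: if_cong)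

lemma norm_unit_vector: "koethe_norm W (unit_vector n :: nat \<Rightarrow> 'k) = 1"
proof (rule antisym)
  show "koethe_norm W (unit_vector n :: nat \<Rightarrow> 'k) \<le> 1"
  proof (rule norm_le)
    fix w assume w: "w \<in> W"
    have "pairing w (unit_vector n :: nat \<Rightarrow> 'k) = (\<Sum>i\<in>{n} \<union> {i. w i \<noteq> 0}. w i * norm (unit_vector n i :: 'k))"
      by (rule pairing_eq_sum) (use W_finite[OF w] in auto)
    also have "\<dots> = (\<Sum>i\<in>{n}. w i * norm (unit_vector n i :: 'k))"
      by (rule sum.mono_neutral_right) (use W_finite[OF w] in \<open>auto simp: unit_vector_def\<close>)
    finally show "pairing w (unit_vector n :: nat \<Rightarrow> 'k) \<le> 1" using W_le1[OF w] by (simp add: unit_vector_def)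
  qed
  show "1 \<le> koethe_norm W (unit_vector n :: nat \<Rightarrow> 'k)"
    using coord_le[OF unit_vector_seqs, of n n] by (simp add: unit_vector_def)
qed

lemma finsum_unit_vectors:
  "finite F \<Longrightarrow> (\<Oplus>\<^bsub>X\<^esub>n\<in>F. c n \<odot>\<^bsub>X\<^esub> j (unit_vector n)) = j (\<lambda>i. if i \<in> F then c i else 0)"
  using seqs_scale(1)[OF unit_vector_seqs] unit_vector_sum[of F c]
  by (simp add: finsum_X)

lemma span_unit_vectors:
  assumes "z \<in> lin_span X ((\<lambda>n. j (unit_vector n)) ` {1..})"
  obtains N b where "z = j b" "b \<in> koethe_seqs W" "\<And>i. i > N \<or> i = 0 \<Longrightarrow> b i = 0"
proof -
  obtain c F where F: "finite F" "F \<subseteq> (\<lambda>n. j (unit_vector n)) ` {1..}" and z: "z = (\<Oplus>\<^bsub>X\<^esub>b\<in>F. c b \<odot>\<^bsub>X\<^esub> b)"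
    using assms unfolding lin_span_def by blast
  obtain G where G: "finite G" "G \<subseteq> {1..}" and FG: "F = (\<lambda>n. j (unit_vector n)) ` G"
    using finite_subset_image[OF F] by blast
  have inj: "inj_on (\<lambda>n. j (unit_vector n)) G"
    by (auto simp: inj_on_def inj_eq[OF inj_j] unit_vector_def fun_eq_iff)
  have "z = (\<Oplus>\<^bsub>X\<^esub>n\<in>G. c (j (unit_vector n)) \<odot>\<^bsub>X\<^esub> j (unit_vector n))"
    unfolding z FG by (rule X.finsum_reindex) (use inj seqs_scale(1)[OF unit_vector_seqs] in auto)
  also have "\<dots> = j (\<lambda>i. if i \<in> G then c (j (unit_vector i)) else 0)"
    by (rule finsum_unit_vectors[OF G(1)])
  finally show ?thesis
    using G by (intro that[of "\<lambda>i. if i \<in> G then c (j (unit_vector i)) else 0" "Max (insert 0 G)"]) (auto intro!: seqs_finite_support[of G])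
qed

text \<open>An element of the closed span is approximated by finitely supported sequences, and its
  own truncations do at least as well by monotonicity of the norm, so the coordinate expansion
  converges. Its coefficients are unique because the norm controls coordinates.\<close>

lemma basic_unit_vectors: "basic_sequence X (\<lambda>n. j (unit_vector n))"
  unfolding basic_sequence_def schauder_basis_on_def
proof (intro conjI allI impI ballI)
  let ?x = "\<lambda>n. j (unit_vector n)"
  let ?V = "M.mtopology closure_of lin_span X (?x ` {1..})"
  show "?x n \<in> carrier X" for n using unit_vector_seqs by simp
  show "?x n \<in> ?V" if "n \<ge> 1" for n
  proof -
    have "lin_span X (?x ` {1..}) \<subseteq> M.mtopology closure_of lin_span X (?x ` {1..})"
    proof (rule closure_of_subset, unfold M.topspace_mtopology, rule subsetI)
      fix z assume "z \<in> lin_span X (?x ` {1..})"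
      then obtain b where "z = j b" "b \<in> koethe_seqs W" by (rule span_unit_vectors)
      then show "z \<in> carrier X" by simp
    qed
    moreover have "?x n \<in> lin_span X (?x ` {1..})"
      unfolding lin_span_def using that unit_vector_seqs[of n]
      by (auto intro!: exI[of _ "\<lambda>_. 1"] exI[of _ "{?x n}"] simp: X.finsum_insert)
    ultimately show ?thesis by blast
  qed
  fix y assume "y \<in> ?V"
  then have y: "y \<in> carrier X"
    and "\<forall>r>0. \<exists>z\<in>lin_span X (?x ` {1..}). z \<in> M.mball y r"
    unfolding M.metric_closure_of by blast+
  then have app: "\<And>r. r > 0 \<Longrightarrow> \<exists>z\<in>lin_span X (?x ` {1..}). ndist X y z < r"
    unfolding M.in_mball by blast
  from y obtain a where a: "y = j a" "a \<in> koethe_seqs W" by auto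
  have P: "(\<lambda>i. if i \<in> {1..N} then b i else 0) \<in> koethe_seqs W" for N and b :: "nat \<Rightarrow> 'k"
    by (rule seqs_finite_support[of "{1..N}"]) auto
  have conv: "series_converges_to X b ?x y \<longleftrightarrow>
    (\<forall>e>0. \<exists>N. \<forall>n\<ge>N. koethe_norm W (\<lambda>i. (if i \<in> {1..n} then b i else 0) - a i) < e)" for b
    unfolding series_converges_to_def M.limit_metric_sequentially
    using P[of _ b] a(2) by (simp only: finsum_unit_vectors finite_atLeastAtMost a(1)) (simp del: atLeastAtMost_iff)
  have "series_converges_to X a ?x y"
    unfolding conv
  proof (intro allI impI)
    fix e :: real assume "e > 0"
    then obtain z where z: "z \<in> lin_span X (?x ` {1..})" "ndist X y z < e" using app by blast
    obtain N b where b: "z = j b" "b \<in> koethe_seqs W" "\<And>i. i > N \<or> i = 0 \<Longrightarrow> b i = 0"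
      using span_unit_vectors[OF z(1)] by blast
    have d: "koethe_norm W (\<lambda>i. a i - b i) < e" using z(2) b a by simp
    \<comment> \<open>Coordinatewise comparison: up to \<open>n\<close> the left side vanishes, and
      beyond \<open>N\<close> as well as at index 0 the approximant \<open>b\<close> does.\<close>
    have "koethe_norm W (\<lambda>i. (if i \<in> {1..n} then a i else 0) - a i) \<le> koethe_norm W (\<lambda>i. a i - b i)"
      if "n \<ge> N" for n
      by (rule seqs_mono(2)[OF seqs_diff[OF a(2) b(2)]]) (use b(3) that in auto)
    then show "\<exists>N. \<forall>n\<ge>N. koethe_norm W (\<lambda>i. (if i \<in> {1..n} then a i else 0) - a i) < e"
      using d le_less_trans by blast
  qed
  moreover have "b n = a n" if bn: "series_converges_to X b ?x y" "n \<ge> 1" for b n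
  proof (rule ccontr)
    assume "b n \<noteq> a n"
    then have "norm (b n - a n) > 0" by simp
    then obtain N where N: "\<And>k. k \<ge> N \<Longrightarrow>
        koethe_norm W (\<lambda>i. (if i \<in> {1..k} then b i else 0) - a i) < norm (b n - a n)"
      using bn(1) unfolding conv by blast
    \<comment> \<open>At any stage from \<open>n\<close> on, the \<open>n\<close>-th coordinate of
      the error is already \<open>b n - a n\<close>.\<close>
    show False
      using N[of "max N n"] coord_le[OF seqs_diff[OF P[of "max N n" b] a(2)], of n] \<open>n \<ge> 1\<close> by simp
  qed
  ultimately show "\<exists>a. series_converges_to X a ?x y \<and>
      (\<forall>b. series_converges_to X b ?x y \<longrightarrow> (\<forall>n\<ge>1. b n = a n))" by blast
qed

end


section \<open>Large sets in Schreier families\<close>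

lemma schreier_finite_subset: "schreier L \<xi> F \<Longrightarrow> finite F \<and> F \<subseteq> {1..}"
proof (induction rule: schreier.induct)
  case (succ \<xi> \<zeta> n G)
  then have "finite (G k) \<and> G k \<subseteq> {1..}" if "k \<in> {1..n}" for k using that by blast
  then show ?case by blast
qed auto

lemma schreier_family_finite_subset:
  "F \<in> schreier_family L \<xi> \<Longrightarrow> finite F \<and> F \<subseteq> {1..}"
  unfolding schreier_family_def using schreier_finite_subset[of L \<xi> F] by (simp split: if_splits)

text \<open>The assumptions on \<open>\<zeta>\<close> and \<open>\<xi>\<close> say that
  \<open>\<xi>\<close> is the ordinal 1. The set is cut into singletons in increasing order; there
  are at most \<open>n\<close> of them and its minimum exceeds \<open>n\<close>.\<close>

lemma schreier_one:
  assumes "{..<\<zeta>} = {}" "{..<\<xi>} = {..\<zeta>}" "finite F" "card F \<le> n" "F \<subseteq> {Suc n..}"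
  shows "schreier L \<xi> F"
proof (cases "F = {}")
  case True then show ?thesis by (simp add: schreier.empty)
next
  case False
  define l where "l = sorted_list_of_set F"
  have l: "set l = F" "length l = card F" "sorted l" "distinct l"
    using assms(3) by (simp_all add: l_def)
  have pos: "card F \<ge> 1" using False assms(3) by (simp add: Suc_leI card_gt_0_iff)
  have mem: "l ! i \<in> F" if "i < card F" for i using l that nth_mem by metis
  \<comment> \<open>The shift \<open>k - 1\<close> reconciles pieces numbered from 1 with list
    positions numbered from 0.\<close>
  have "schreier L \<xi> (\<Union>k\<in>{1..card F}. {l ! (k - 1)})"
  proof (rule schreier.succ[OF assms(2) pos])
    show "schreier L \<zeta> {l ! (k - 1)}" if "k \<in> {1..card F}" for k
    proof (rule schreier.zero[OF assms(1)])
      have "l ! (k - 1) \<in> F" by (rule mem) (use that in auto)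
      then show "l ! (k - 1) \<ge> 1" using assms(5) by auto
    qed
    show "card F \<le> Min {l ! (1 - 1)}"
      using mem[of 0] assms(4,5) pos by auto
    show "Max {l ! (k - 1)} < Min {l ! (Suc k - 1)}" if "k \<in> {1..<card F}" for k
      using sorted_wrt_nth_less[OF strict_sorted_iff[THEN iffD2], of l "k - 1" k] that l by auto
  qed auto
  also have "(\<Union>k\<in>{1..card F}. {l ! (k - 1)}) = F"
  proof -
    have "(\<lambda>k. l ! (k - 1)) ` {1..card F} = (!) l ` {..<card F}"
      unfolding image_Suc_lessThan[symmetric] image_image by simp
    also have "\<dots> = F" using l(1,2) by (auto simp: set_conv_nth image_def)
    finally show ?thesis by (simp only: UNION_singleton_eq_range)
  qed
  finally show ?thesis .
qed

text \<open>For each fixed cardinality, all sets that start late enough are Schreier sets. Induction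
  on \<open>\<xi>\<close>: the ordinal 1 is \<open>schreier_one\<close>, later successors inherit
  sets as one-piece unions, and limits inherit them from a nonzero term of the ladder.\<close>

lemma schreier_large:
  assumes L: "ladder_system L"
  shows "{..<\<xi>} \<noteq> {} \<Longrightarrow> countable {..<\<xi>} \<Longrightarrow>
    \<exists>N\<ge>1. \<forall>F. finite F \<longrightarrow> card F \<le> n \<longrightarrow> F \<subseteq> {N..} \<longrightarrow> schreier L \<xi> F"
proof (induction \<xi> rule: less_induct)
  case (less \<xi>)
  have countable_less: "countable {..<\<eta>}" if "\<eta> < \<xi>" for \<eta>
    by (rule countable_subset[OF _ less.prems(2)]) (use that in auto)
  show ?case
  proof (cases "\<exists>\<zeta>. {..<\<xi>} = {..\<zeta>}")
    case True
    then obtain \<zeta> where \<zeta>: "{..<\<xi>} = {..\<zeta>}" by blast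
    then have lt: "\<zeta> < \<xi>" by auto
    show ?thesis
    proof (cases "{..<\<zeta>} = {}")
      case True
      then show ?thesis using schreier_one[OF True \<zeta>] by (intro exI[of _ "Suc n"]) auto
    next
      case False
      obtain N where N: "N \<ge> 1" "\<And>F. finite F \<Longrightarrow> card F \<le> n \<Longrightarrow> F \<subseteq> {N..} \<Longrightarrow> schreier L \<zeta> F"
        using less.IH[OF lt False countable_less[OF lt]] by blast
      have "schreier L \<xi> F" if F: "finite F" "card F \<le> n" "F \<subseteq> {N..}" for F
      proof (cases "F = {}")
        case True then show ?thesis by (simp add: schreier.empty)
      next
        case False
        have "schreier L \<xi> (\<Union>k\<in>{1..1::nat}. F)"
        proof (rule schreier.succ[where G = "\<lambda>_. F" and n = 1, OF \<zeta>])
          have "Min F \<in> F" using False F by simp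
          then show "1 \<le> Min F" using F N(1) by auto
        next
          show "schreier L \<zeta> F" by (rule N(2)[OF F])
        qed (use False in auto)
        then show ?thesis by simp
      qed
      then show ?thesis using N(1) by blast
    qed
  next
    case False
    with less.prems have lim: "limit_ordinal \<xi>" by (simp add: limit_ordinal_def)
    with L less.prems have mono: "strict_mono_on {1..} (L \<xi>)"
      and sup: "\<And>\<eta>. (\<forall>n\<ge>1. L \<xi> n \<le> \<eta>) \<longleftrightarrow> \<xi> \<le> \<eta>"
      unfolding ladder_system_def by simp_all
    \<comment> \<open>The first term of the ladder may be 0, whose family contains no set with two
      elements. The second term is nonzero, and comparison with the third shows that it lies
      strictly below \<open>\<xi>\<close>.\<close>
    have L12: "L \<xi> 1 < L \<xi> 2" and L23: "L \<xi> 2 < L \<xi> 3"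
      using mono by (auto simp: strict_mono_on_def)
    have "L \<xi> 3 \<le> \<xi>" using sup[of \<xi>] by simp
    with L23 have lt: "L \<xi> 2 < \<xi>" by (rule less_le_trans)
    have ne: "{..<L \<xi> 2} \<noteq> {}" using L12 by blast
    obtain N where N: "\<And>F. finite F \<Longrightarrow> card F \<le> n \<Longrightarrow> F \<subseteq> {N..} \<Longrightarrow> schreier L (L \<xi> 2) F"
      using less.IH[OF lt ne countable_less[OF lt]] by blast
    \<comment> \<open>The bound 2 is the condition that the limit clause attaches to the second
      ladder term.\<close>
    have "schreier L \<xi> F" if "finite F" "card F \<le> n" "F \<subseteq> {max N 2..}" for F
    proof (rule schreier.limit[OF lim])
      show "schreier L (L \<xi> 2) F" using that by (intro N) auto
      show "\<forall>m\<in>F. 2 \<le> m" using that by auto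
    qed simp
    then show ?thesis by (intro exI[of _ "max N 2"]) simp
  qed
qed

lemma schreier_family_large:
  assumes "ladder_system L" "{..<\<xi>} \<noteq> {}"
  obtains N where "N \<ge> 1" "\<And>F. finite F \<Longrightarrow> card F \<le> n \<Longrightarrow> F \<subseteq> {N..} \<Longrightarrow> F \<in> schreier_family L \<xi>"
proof (cases "countable {..<\<xi>}")
  case True
  then show ?thesis
    using that schreier_large[OF assms True, of n] unfolding schreier_family_def by auto
next
  case False
  then show ?thesis using that[of 1] unfolding schreier_family_def by auto
qed


section \<open>Gliding humps in the space of summable sequences\<close>

text \<open>Bolzano-Weierstrass, iterated once for each of the first \<open>M\<close>
  coordinates.\<close>

lemma bounded_seqs_convergent_subseq:
  fixes u :: "nat \<Rightarrow> nat \<Rightarrow> 'k::{real_normed_field, heine_borel}"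
  assumes "\<And>m i. norm (u m i) \<le> 1"
  shows "\<exists>r::nat \<Rightarrow> nat. strict_mono r \<and> (\<forall>i<M. convergent (\<lambda>n. u (r n) i))"
proof (induction M)
  case 0 show ?case by (intro exI[of _ id]) (simp add: strict_mono_def)
next
  case (Suc M)
  then obtain r :: "nat \<Rightarrow> nat" where r: "strict_mono r" "\<And>i. i < M \<Longrightarrow> convergent (\<lambda>n. u (r n) i)"
    by blast
  have "bounded (range (\<lambda>n. u (r n) M))"
    using assms by (auto simp: bounded_iff)
  then obtain l s where s: "strict_mono s" "((\<lambda>n. u (r n) M) \<circ> s) \<longlonglongrightarrow> l"
    using bounded_imp_convergent_subsequence by blast
  have "convergent (\<lambda>n. u ((r \<circ> s) n) i)" if "i < Suc M" for i
  proof (cases "i = M")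
    case True then show ?thesis using s(2) by (auto simp: convergent_def o_def)
  next
    case False
    then show ?thesis
      using convergent_subseq_convergent[OF r(2)[of i] s(1)] that by (simp add: o_def)
  qed
  then show ?case using strict_mono_o[OF r(1) s(1)] by blast
qed

text \<open>Two consecutive terms, far out, of a subsequence that converges in the first
  \<open>M\<close> coordinates.\<close>

lemma bounded_seqs_close_pair:
  fixes u :: "nat \<Rightarrow> nat \<Rightarrow> 'k::{real_normed_field, heine_borel}"
  assumes "\<And>m i. norm (u m i) \<le> 1" "0 < \<delta>"
  obtains m m' where "N \<le> m" "m < m'" "(\<Sum>i<M. norm (u m i - u m' i)) < \<delta>"
proof -
  obtain r :: "nat \<Rightarrow> nat" where r: "strict_mono r" "\<And>i. i < M \<Longrightarrow> convergent (\<lambda>n. u (r n) i)"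
    using bounded_seqs_convergent_subseq[where u = u, OF assms(1)] by blast
  have l: "(\<lambda>n. u (r n) i) \<longlonglongrightarrow> lim (\<lambda>n. u (r n) i)" if "i < M" for i
    using r(2)[OF that] by (simp add: convergent_LIMSEQ_iff)
  have "(\<lambda>n. \<Sum>i<M. norm (u (r n) i - u (r (Suc n)) i)) \<longlonglongrightarrow>
      (\<Sum>i<M. norm (lim (\<lambda>n. u (r n) i) - lim (\<lambda>n. u (r n) i)))"
    by (intro tendsto_intros l LIMSEQ_Suc[OF l]) auto
  then have "\<forall>\<^sub>F n in sequentially. (\<Sum>i<M. norm (u (r n) i - u (r (Suc n)) i)) < \<delta>"
    using assms(2) by (intro order_tendstoD) auto
  then obtain n where n: "n \<ge> N" "(\<Sum>i<M. norm (u (r n) i - u (r (Suc n)) i)) < \<delta>"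
    unfolding eventually_sequentially by (meson linear order_refl)
  show ?thesis
    by (rule that[of "r n" "r (Suc n)"])
      (use n strict_mono_imp_increasing[OF r(1), of n] strict_monoD[OF r(1), of n "Suc n"] in auto)
qed

lemma bounded_sums_tail:
  fixes f :: "nat \<Rightarrow> real"
  assumes "\<And>i. 0 \<le> f i" "\<And>G. finite G \<Longrightarrow> sum f G \<le> B" "0 < \<delta>"
  obtains M where "\<And>G. finite G \<Longrightarrow> G \<subseteq> {M..} \<Longrightarrow> sum f G < \<delta>"
proof -
  have "summable f"
    by (rule bounded_imp_summable[of _ B]) (use assms in auto)
  then obtain M where M: "\<And>m n. m \<ge> M \<Longrightarrow> norm (sum f {m..<n}) < \<delta>"
    unfolding summable_Cauchy using assms(3) by blast
  have "sum f G < \<delta>" if G: "finite G" "G \<subseteq> {M..}" for G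
  proof -
    have "sum f G \<le> sum f {M..<Suc (Max (insert 0 G))}"
      by (rule sum_mono2) (use G assms(1) in \<open>auto simp: less_Suc_eq_le\<close>)
    then show ?thesis using M[of M "Suc (Max (insert 0 G))"] by simp
  qed
  then show ?thesis using that by blast
qed

text \<open>Compactness gives two late terms that nearly agree before the current interval;
  summability of their difference then fixes where the interval ends. Differences are taken because
  the coordinatewise limits need not be 0.\<close>

lemma gliding_hump:
  fixes u :: "nat \<Rightarrow> nat \<Rightarrow> 'k::{real_normed_field, heine_borel}"
  assumes u: "\<And>m G. finite G \<Longrightarrow> (\<Sum>i\<in>G. norm (u m i)) \<le> 1" and \<delta>: "0 < \<delta>"
  obtains t b :: "nat \<Rightarrow> nat" where "strict_mono t" "N \<le> t 0" "strict_mono b"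
    "\<And>k G. finite G \<Longrightarrow> G \<inter> {b k..<b (Suc k)} = {} \<Longrightarrow>
      (\<Sum>i\<in>G. norm (u (t (2 * k)) i - u (t (2 * k + 1)) i)) \<le> \<delta>"
proof -
  \<comment> \<open>A state holds the indices \<open>m < m'\<close> of a pair and the interval from
    \<open>lo\<close> to \<open>hi\<close> carrying its difference up to \<open>\<delta>\<close>.
    The relation \<open>Q\<close> lets the next pair come later and the next interval start where
    this one ends.\<close>
  define P :: "nat \<Rightarrow> nat \<times> nat \<times> nat \<times> nat \<Rightarrow> bool" where
    "P = (\<lambda>_ (m, m', lo, hi). N \<le> m \<and> m < m' \<and> lo < hi \<and>
      (\<forall>G. finite G \<longrightarrow> G \<inter> {lo..<hi} = {} \<longrightarrow> (\<Sum>i\<in>G. norm (u m i - u m' i)) \<le> \<delta>))"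
  define Q :: "nat \<Rightarrow> nat \<times> nat \<times> nat \<times> nat \<Rightarrow> nat \<times> nat \<times> nat \<times> nat \<Rightarrow> bool" where
    "Q = (\<lambda>_ (_, m', _, hi) (m, _, lo, _). m' < m \<and> hi = lo)"
  have u1: "norm (u m i) \<le> 1" for m i using u[of "{i}" m] by simp
  have step: "\<exists>m m' hi. K \<le> m \<and> P n (m, m', lo, hi)" if "N \<le> K" for K lo n
  proof -
    obtain m m' where m: "K \<le> m" "m < m'" "(\<Sum>i<lo. norm (u m i - u m' i)) < \<delta> / 2"
      by (rule bounded_seqs_close_pair[where u = u and \<delta> = "\<delta> / 2" and N = K and M = lo, OF u1])
        (use \<delta> in auto)
    have "(\<Sum>i\<in>G. norm (u m i - u m' i)) \<le> 2" if "finite G" for G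
    proof -
      have "(\<Sum>i\<in>G. norm (u m i - u m' i)) \<le> (\<Sum>i\<in>G. norm (u m i) + norm (u m' i))"
        by (intro sum_mono norm_triangle_ineq4)
      then show ?thesis using u[OF that, of m] u[OF that, of m'] by (simp add: sum.distrib)
    qed
    then obtain M where M: "\<And>G. finite G \<Longrightarrow> G \<subseteq> {M..} \<Longrightarrow> (\<Sum>i\<in>G. norm (u m i - u m' i)) < \<delta> / 2"
      using bounded_sums_tail[of "\<lambda>i. norm (u m i - u m' i)" 2 "\<delta> / 2"] \<delta> by auto
    have "(\<Sum>i\<in>G. norm (u m i - u m' i)) \<le> \<delta>"
      \<comment> \<open>Half of \<open>\<delta>\<close> is spent below \<open>lo\<close> and half
        from \<open>M\<close> on. The maximum with \<open>Suc lo\<close> keeps the interval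
        nonempty.\<close>
      if G: "finite G" "G \<inter> {lo..<max M (Suc lo)} = {}" for G
    proof -
      have "(\<Sum>i\<in>G. norm (u m i - u m' i)) =
          (\<Sum>i\<in>G \<inter> {..<lo}. norm (u m i - u m' i)) + (\<Sum>i\<in>G - {..<lo}. norm (u m i - u m' i))"
        using G(1) by (rule sum.Int_Diff)
      moreover have "(\<Sum>i\<in>G \<inter> {..<lo}. norm (u m i - u m' i)) \<le> (\<Sum>i<lo. norm (u m i - u m' i))"
        by (rule sum_mono2) auto
      moreover have "(\<Sum>i\<in>G - {..<lo}. norm (u m i - u m' i)) < \<delta> / 2"
      proof (rule M)
        show "G - {..<lo} \<subseteq> {M..}"
        proof
          fix i assume i: "i \<in> G - {..<lo}"
          then have "i \<notin> {lo..<max M (Suc lo)}" using G(2) by blast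
          with i show "i \<in> {M..}" by auto
        qed
      qed (use G in auto)
      ultimately show ?thesis using m(3) by linarith
    qed
    moreover have "N \<le> m" "lo < max M (Suc lo)" using m(1) that by simp_all
    ultimately have "P n (m, m', lo, max M (Suc lo))"
      unfolding P_def prod.case using m(2) by blast
    with m(1) show ?thesis by blast
  qed
  have "\<exists>f. \<forall>n. P n (f n) \<and> Q n (f n) (f (Suc n))"
  proof (rule dependent_nat_choice)
    show "\<exists>x. P 0 x" using step[of N] by blast
    fix x n assume "P n x"
    moreover obtain m m' lo hi where x: "x = (m, m', lo, hi)" by (cases x) auto
    ultimately have "N \<le> Suc m'" by (auto simp: P_def)
    from step[OF this, of "Suc n" hi] obtain m2 m2' hi2
      where m2: "Suc m' \<le> m2" "P (Suc n) (m2, m2', hi, hi2)" by blast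
    then have "Q n x (m2, m2', hi, hi2)" by (simp add: x Q_def)
    with m2(2) show "\<exists>y. P (Suc n) y \<and> Q n x y" by blast
  qed
  then obtain f where P: "\<And>n. P n (f n)" and Q: "\<And>n. Q n (f n) (f (Suc n))" by blast
  define s s' b where "s k = fst (f k)" and "s' k = fst (snd (f k))"
    and "b k = fst (snd (snd (f k)))" for k
  have f: "f k = (s k, s' k, b k, b (Suc k))" for k
    using Q[of k] by (cases "f k", cases "f (Suc k)") (simp add: Q_def s_def s'_def b_def)
  \<comment> \<open>The two members of each pair are interleaved into one increasing
    sequence.\<close>
  define t where "t l = (if even l then s (l div 2) else s' (l div 2))" for l
  have PP: "N \<le> s k" "s k < s' k" "b k < b (Suc k)"
    "\<And>G. finite G \<Longrightarrow> G \<inter> {b k..<b (Suc k)} = {} \<Longrightarrow> (\<Sum>i\<in>G. norm (u (s k) i - u (s' k) i)) \<le> \<delta>" for k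
    using P[of k] by (auto simp: P_def f)
  have s's: "s' k < s (Suc k)" for k using Q[of k] by (simp add: Q_def f)
  show ?thesis
  proof
    show "strict_mono t"
      unfolding strict_mono_Suc_iff using PP(2) s's by (auto simp: t_def elim!: evenE oddE)
    show "strict_mono b" using PP(3) by (simp add: strict_mono_Suc_iff)
  qed (use PP in \<open>auto simp: t_def\<close>)
qed


section \<open>Weights with separated levels\<close>

lemma sum_lessThan_double:
  fixes f :: "nat \<Rightarrow> 'a::comm_monoid_add"
  shows "sum f {..<2 * n} = (\<Sum>k<n. f (2 * k) + f (2 * k + 1))"
  by (induction n) (simp_all add: algebra_simps)

lemma fast_growing_sequence:
  fixes h :: "nat \<Rightarrow> nat \<Rightarrow> real"
  assumes "0 < s"
  obtains \<nu> :: "nat \<Rightarrow> nat" where "\<nu> 0 = 2" "strict_mono \<nu>" "\<And>k. h k (\<nu> k) \<le> real (\<nu> (Suc k)) powr s"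
proof -
  have "\<exists>f. \<forall>n. (n = 0 \<longrightarrow> f n = 2) \<and> (f n < f (Suc n) \<and> h n (f n) \<le> real (f (Suc n)) powr s)"
  proof (rule dependent_nat_choice)
    show "\<exists>x::nat. 0 = (0::nat) \<longrightarrow> x = 2" by blast
    fix x n :: nat
    \<comment> \<open>Taking the power \<open>1 / s\<close> inverts the required bound;
      \<open>Suc x\<close> enforces strict growth.\<close>
    define y where "y = max (Suc x) (nat \<lceil>max 0 (h n x) powr (1 / s)\<rceil>)"
    have "max 0 (h n x) = (max 0 (h n x) powr (1 / s)) powr s"
      using assms by (simp add: powr_powr)
    also have "\<dots> \<le> real y powr s"
      using assms by (intro powr_mono2) (auto simp: y_def intro: order_trans[OF real_nat_ceiling_ge])
    finally have "x < y \<and> h n x \<le> real y powr s" by (simp add: y_def)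
    then show "\<exists>y. (Suc n = 0 \<longrightarrow> y = 2) \<and> (x < y \<and> h n x \<le> real y powr s)" by blast
  qed
  then show ?thesis using that by (metis strict_mono_Suc_iff)
qed

text \<open>The growth condition makes \<open>n powr (1 / p)\<close> with
  \<open>n = \<nu> (Suc k)\<close> at least \<open>k\<close> times the bound of
  \<open>sum_parity_weights_le\<close>, so no fixed constant can compensate for a missing
  level.\<close>

locale levels =
  fixes p q :: real and \<nu> :: "nat \<Rightarrow> nat"
  assumes p: "1 < p" and q: "1 < q" and conj: "1 / p + 1 / q = 1"
    and \<nu>0: "\<nu> 0 = 2" and \<nu>_mono: "strict_mono \<nu>"
    and \<nu>_growth: "\<And>k. real k * (real (\<nu> k) powr (q - 1) + 1) \<le> real (\<nu> (Suc k)) powr (1 / p)"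
begin

text \<open>As \<open>\<nu> 0 = 2\<close>, the value 1 lies in no level, so the coordinate vectors are admissible weights
  at indices of either parity.\<close>

definition level :: "nat \<Rightarrow> real set" where
  "level k = {1 / real (\<nu> (Suc k))<..1 / real (\<nu> k)}"

definition parity_weights :: "(nat \<Rightarrow> real) set" where
  "parity_weights = {w \<in> unit_weights. (\<Sum>i | w i \<noteq> 0. w i powr q) \<le> 1 \<and>
    (\<forall>i k. w i \<in> level k \<longrightarrow> even k = even i)}"

lemma \<nu>_ge2: "2 \<le> \<nu> k"
  using strict_mono_mono[OF \<nu>_mono, THEN monoD, of 0 k] \<nu>0 by simp

lemma level_bounds: "t \<in> level k \<Longrightarrow> 0 < t \<and> t < 1"
proof -
  assume t: "t \<in> level k"
  have "1 / real (\<nu> k) \<le> 1 / 2" using \<nu>_ge2[of k] by (intro divide_left_mono) auto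
  moreover have "0 < 1 / real (\<nu> (Suc k))" using \<nu>_ge2[of "Suc k"] by simp
  ultimately show ?thesis using t unfolding level_def greaterThanAtMost_iff by linarith
qed

lemma level_unique:
  assumes "t \<in> level k" "t \<in> level l" shows "k = l"
proof -
  have False if "k < l" "t \<in> level k" "t \<in> level l" for k l
  proof -
    have "\<nu> (Suc k) \<le> \<nu> l"
      using strict_mono_mono[OF \<nu>_mono] that(1) by (simp add: monoD Suc_leI)
    then have "1 / real (\<nu> l) \<le> 1 / real (\<nu> (Suc k))"
      using \<nu>_ge2[of "Suc k"] by (intro divide_left_mono) auto
    then show False using that(2,3) unfolding level_def greaterThanAtMost_iff by linarith
  qed
  then show ?thesis using assms by (metis linorder_neqE_nat)
qed

lemma parity_weights_unit_weights: "parity_weights \<subseteq> unit_weights"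
  by (auto simp: parity_weights_def)

lemma parity_weights_vec: "(\<lambda>m. if m = i then 1 else 0) \<in> parity_weights"
proof -
  have s: "{m. (if m = i then 1 else 0 :: real) \<noteq> 0} = {i}" by auto
  have "1 \<notin> level k" "0 \<notin> level k" for k using level_bounds[of _ k] by fastforce+
  then show ?thesis unfolding parity_weights_def unit_weights_def by (auto simp: s)
qed

text \<open>Level \<open>k\<close> is forbidden on \<open>J\<close>, so each weight is at most
  \<open>1 / \<nu> (Suc k)\<close> or exceeds \<open>1 / \<nu> k\<close>. The small ones contribute
  at most 1 because \<open>J\<close> has at most \<open>\<nu> (Suc k)\<close> elements. A large one
  is at most \<open>w i powr q * \<nu> k powr (q - 1)\<close>, and the \<open>q\<close>-th powers
  sum to at most 1.\<close>

lemma sum_parity_weights_le: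
  assumes w: "w \<in> parity_weights" and J: "finite J" "card J \<le> \<nu> (Suc k)" "\<And>i. i \<in> J \<Longrightarrow> even i \<noteq> even k"
  shows "sum w J \<le> real (\<nu> k) powr (q - 1) + 1"
proof -
  let ?n = "real (\<nu> (Suc k))" and ?m = "real (\<nu> k)"
  have n: "?n > 0" "?m > 0" using \<nu>_ge2[of "Suc k"] \<nu>_ge2[of k] by simp_all
  have w0: "0 \<le> w i" for i using w by (simp add: parity_weights_def unit_weights_def)
  have fin: "finite {i. w i \<noteq> 0}" using w by (simp add: parity_weights_def unit_weights_def)
  have "w i \<le> w i powr q * ?m powr (q - 1) + 1 / ?n" if "i \<in> J" for i
  proof (cases "w i \<le> 1 / ?n")
    case True then show ?thesis by (simp add: add_increasing)
  next
    case False
    moreover have "w i \<notin> level k" using w J(3)[OF that] by (auto simp: parity_weights_def)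
    ultimately have "1 / ?m < w i" by (simp add: level_def)
    then have "0 < w i" using n by (meson divide_pos_pos less_trans zero_less_one)
    moreover have "1 \<le> ?m * w i" using n \<open>1 / ?m < w i\<close> by (simp add: field_simps)
    ultimately have pos: "0 < w i" "1 \<le> ?m * w i" .
    have "1 powr (q - 1) \<le> (?m * w i) powr (q - 1)"
      using pos(2) q by (intro powr_mono2) auto
    then have "w i * 1 \<le> w i * ((?m * w i) powr (q - 1))"
      using w0[of i] by (intro mult_left_mono) auto
    also have "\<dots> = (w i powr 1 * w i powr (q - 1)) * ?m powr (q - 1)"
      using pos n by (simp add: powr_mult)
    also have "w i powr 1 * w i powr (q - 1) = w i powr q" unfolding powr_add[symmetric] by simp
    finally show ?thesis using n by (simp add: add_increasing2)
  qed
  then have "sum w J \<le> (\<Sum>i\<in>J. w i powr q * ?m powr (q - 1) + 1 / ?n)" by (rule sum_mono)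
  also have "\<dots> = (\<Sum>i\<in>J. w i powr q) * ?m powr (q - 1) + real (card J) / ?n"
    by (simp add: sum.distrib sum_distrib_right)
  also have "\<dots> \<le> 1 * ?m powr (q - 1) + 1"
  proof (intro add_mono mult_right_mono)
    have "(\<Sum>i\<in>J. w i powr q) = (\<Sum>i\<in>J \<inter> {i. w i \<noteq> 0}. w i powr q)"
      using J(1) by (intro sum.mono_neutral_right) auto
    also have "\<dots> \<le> (\<Sum>i | w i \<noteq> 0. w i powr q)"
      by (rule sum_mono2[OF fin]) auto
    also have "\<dots> \<le> 1" using w by (simp add: parity_weights_def)
    finally show "(\<Sum>i\<in>J. w i powr q) \<le> 1" .
    show "real (card J) / ?n \<le> 1" using J(2) n by (simp add: divide_le_eq)
  qed simp
  finally show ?thesis by simp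
qed

text \<open>Each entry of \<open>a\<close> occurs at an even and at an odd coordinate, so every
  value of a norming functional can be put at the copy whose parity suits its level. The split
  functional is admissible and gives the same pairing.\<close>

lemma lp_norm_le_doubled:
  fixes a :: "nat \<Rightarrow> 'k::{real_normed_field, heine_borel}"
  assumes bdd: "(\<lambda>l. a (l div 2)) \<in> koethe_seqs parity_weights"
  shows "(\<Sum>i<M. norm (a i) powr p) powr (1 / p) \<le> koethe_norm parity_weights (\<lambda>l. a (l div 2))"
proof -
  define S where "S = (\<Sum>i<M. norm (a i) powr p)"
  \<comment> \<open>The facts about sequences do not mention \<open>j\<close>, so the identity may
    serve as the injection.\<close>
  interpret weight_family parity_weights "id :: (nat \<Rightarrow> 'k) \<Rightarrow> _"
    by unfold_locales (use parity_weights_unit_weights parity_weights_vec in auto)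
  show ?thesis
  proof (cases "S = 0")
    case True
    then show ?thesis using norm_nonneg[OF bdd] by (simp add: S_def)
  next
    case False
    then have S: "S > 0" unfolding S_def by (simp add: sum_nonneg order.not_eq_order_implies_strict)
    \<comment> \<open>the extremal functional of Hoelder's inequality\<close>
    define w where "w i = (if i < M then (norm (a i) powr p / S) powr (1 / q) else 0)" for i
    \<comment> \<open>A value lying in no level makes \<open>E\<close> false and goes to the odd
      copy, where it is unrestricted.\<close>
    define E where "E t \<longleftrightarrow> (\<exists>k. even k \<and> t \<in> level k)" for t
    define v where "v l = (if even l = E (w (l div 2)) then w (l div 2) else 0)" for l
    have w0: "0 \<le> w i" for i by (simp add: w_def)
    have wq: "w i powr q = norm (a i) powr p / S" if "i < M" for i
      using that q S by (simp add: w_def powr_powr)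
    have sum_wq: "(\<Sum>i<M. w i powr q) = 1"
      using S by (simp add: wq sum_divide_distrib[symmetric] S_def)
    have w1: "w i \<le> 1" for i
    proof (cases "i < M")
      case True
      have "norm (a i) powr p \<le> S" unfolding S_def using True by (intro member_le_sum) auto
      then show ?thesis using True S q by (simp add: w_def powr_le1)
    qed (simp add: w_def)
    have vsup: "{l. v l \<noteq> 0} \<subseteq> {..<2 * M}" by (auto simp: v_def w_def split: if_splits)
    \<comment> \<open>Exactly one of the two copies carries \<open>w i\<close>; the other carries
      0.\<close>
    have v_pair: "f (v (2 * i)) + f (v (2 * i + 1)) = f (w i)" if "f 0 = 0" for f :: "real \<Rightarrow> real" and i
      using that by (simp add: v_def)
    have "v \<in> parity_weights"
      unfolding parity_weights_def mem_Collect_eq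
    proof (intro conjI allI impI)
      show "v \<in> unit_weights"
        using finite_subset[OF vsup] w0 w1 by (auto simp: unit_weights_def v_def)
      have "(\<Sum>l | v l \<noteq> 0. v l powr q) = (\<Sum>l<2 * M. v l powr q)"
        by (rule sum.mono_neutral_left) (use vsup in auto)
      also have "\<dots> = (\<Sum>i<M. w i powr q)"
        unfolding sum_lessThan_double by (intro sum.cong refl v_pair[of "\<lambda>x. x powr q"]) simp
      finally show "(\<Sum>l | v l \<noteq> 0. v l powr q) \<le> 1" using sum_wq by simp
      fix l k assume k: "v l \<in> level k"
      then have "v l \<noteq> 0" using level_bounds by force
      then have "even l = E (w (l div 2))" and "w (l div 2) \<in> level k"
        using k by (auto simp: v_def split: if_splits)
      then show "even k = even l" using level_unique unfolding E_def by metis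
    qed
    have "S powr (1 / p) = S powr 1 * S powr (- (1 / q))"
      unfolding powr_add[symmetric] using conj by (intro arg_cong2[where f = "(powr)"]) auto
    also have "\<dots> = S * S powr (- (1 / q))" using S by simp
    also have "\<dots> = (\<Sum>i<M. norm (a i) powr p * S powr (- (1 / q)))"
      by (simp add: S_def sum_distrib_right)
    also have "\<dots> = (\<Sum>i<M. w i * norm (a i))"
    proof (rule sum.cong[OF refl])
      fix i assume i: "i \<in> {..<M}"
      have pq: "p * (1 / q) + 1 = p"
      proof -
        have "p * (1 / p + 1 / q) = p" using conj by simp
        then show ?thesis using p by (simp add: distrib_left)
      qed
      have "w i * norm (a i) = norm (a i) powr (p * (1 / q)) * norm (a i) powr 1 * S powr (- (1 / q))"
        using i S by (simp add: w_def powr_divide powr_powr powr_minus_divide)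
      also have "norm (a i) powr (p * (1 / q)) * norm (a i) powr 1 = norm (a i) powr p"
        unfolding powr_add[symmetric] pq ..
      finally show "norm (a i) powr p * S powr (- (1 / q)) = w i * norm (a i)" by simp
    qed
    also have "\<dots> = (\<Sum>i<M. v (2 * i) * norm (a i) + v (2 * i + 1) * norm (a i))"
      by (intro sum.cong refl v_pair[of "\<lambda>x. x * norm (a _)", symmetric]) simp
    also have "\<dots> = (\<Sum>l<2 * M. v l * norm (a (l div 2)))"
      unfolding sum_lessThan_double by simp
    also have "\<dots> = pairing v (\<lambda>l. a (l div 2))"
      by (rule pairing_eq_sum[symmetric]) (use vsup in auto)
    also have "\<dots> \<le> koethe_norm parity_weights (\<lambda>l. a (l div 2))"
      by (rule pairing_le_norm[OF bdd \<open>v \<in> parity_weights\<close>])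
    finally show ?thesis by (simp add: S_def)
  qed
qed

section \<open>Sequences placed on the coordinates of one parity\<close>

definition place :: "nat \<Rightarrow> (nat \<Rightarrow> 'k::zero) \<Rightarrow> nat \<Rightarrow> 'k" where
  "place c a l = (if even l = even c then a (l div 2) else 0)"

text \<open>An admissible weight read along one parity class is a weight of
  \<open>\<ell>\<^sub>1\<close>. This makes placement a contraction.\<close>

lemma pairing_place:
  assumes "w \<in> parity_weights" "c < 2"
  shows "pairing w (place c a) = pairing (\<lambda>i. w (2 * i + c)) a"
    and "(\<lambda>i. w (2 * i + c)) \<in> unit_weights"
proof -
  have fin: "finite {l. w l \<noteq> 0}" and w: "0 \<le> w l" "w l \<le> 1" for l
    using assms(1) by (simp_all add: parity_weights_def unit_weights_def)
  then obtain M where M: "{l. w l \<noteq> 0} \<subseteq> {..<M}" using finite_nat_iff_bounded by blast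
  have c: "c = 0 \<or> c = 1" using assms(2) by auto
  have sub: "{i. w (2 * i + c) \<noteq> 0} \<subseteq> {..<M}"
    using M by (auto simp: subset_iff)
  have "pairing w (place c a) = (\<Sum>l<2 * M. w l * norm (place c a l))"
    by (rule pairing_eq_sum) (use M in auto)
  also have "\<dots> = (\<Sum>i<M. w (2 * i + c) * norm (a i))"
    unfolding sum_lessThan_double using c by (intro sum.cong) (auto simp: place_def)
  also have "\<dots> = pairing (\<lambda>i. w (2 * i + c)) a"
    by (rule pairing_eq_sum[symmetric]) (use sub in auto)
  finally show "pairing w (place c a) = pairing (\<lambda>i. w (2 * i + c)) a" .
  show "(\<lambda>i. w (2 * i + c)) \<in> unit_weights"
    unfolding unit_weights_def using w finite_subset[OF sub] by simp
qed

text \<open>On the hump the weights are replaced by their maximum there, and off the hump by 1. Each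
  hump thus tests the weight at a single coordinate.\<close>

lemma pairing_place_hump:
  assumes w: "w \<in> parity_weights" and c: "c < 2"
    and v: "\<And>G. finite G \<Longrightarrow> (\<Sum>i\<in>G. norm (v i)) \<le> 2"
    and tail: "\<And>G. finite G \<Longrightarrow> G \<inter> {b..<b'} = {} \<Longrightarrow> (\<Sum>i\<in>G. norm (v i)) \<le> \<delta>"
    and b: "b < b'"
  shows "\<exists>i\<in>{b..<b'}. pairing w (place c v) \<le> 2 * w (2 * i + c) + \<delta>"
proof -
  let ?w = "\<lambda>i. w (2 * i + c)"
  have uw: "?w \<in> unit_weights" by (rule pairing_place(2)[OF w c])
  then have w0: "0 \<le> ?w i" "?w i \<le> 1" for i by (simp_all add: unit_weights_def)
  define G where "G = {i. ?w i \<noteq> 0}"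
  have G: "finite G" using uw by (simp add: G_def unit_weights_def)
  obtain i where i: "i \<in> {b..<b'}" "\<And>l. l \<in> {b..<b'} \<Longrightarrow> ?w l \<le> ?w i"
  proof -
    have ne: "?w ` {b..<b'} \<noteq> {}" "finite (?w ` {b..<b'})" using b by auto
    obtain i where "i \<in> {b..<b'}" "Max (?w ` {b..<b'}) = ?w i" using Max_in[OF ne(2,1)] by blast
    then show ?thesis using that[of i] Max_ge[OF ne(2)] by (metis imageI)
  qed
  have "pairing w (place c v) = (\<Sum>l\<in>G. ?w l * norm (v l))"
    unfolding pairing_place(1)[OF w c] by (rule pairing_eq_sum[OF G]) (simp add: G_def)
  also have "\<dots> = (\<Sum>l\<in>G \<inter> {b..<b'}. ?w l * norm (v l)) + (\<Sum>l\<in>G - {b..<b'}. ?w l * norm (v l))"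
    using G by (rule sum.Int_Diff)
  also have "\<dots> \<le> (\<Sum>l\<in>G \<inter> {b..<b'}. ?w i * norm (v l)) + (\<Sum>l\<in>G - {b..<b'}. 1 * norm (v l))"
    by (intro add_mono sum_mono mult_right_mono i(2) w0(2)) auto
  also have "\<dots> = ?w i * (\<Sum>l\<in>G \<inter> {b..<b'}. norm (v l)) + (\<Sum>l\<in>G - {b..<b'}. norm (v l))"
    by (simp add: sum_distrib_left)
  also have "\<dots> \<le> ?w i * 2 + \<delta>"
    by (intro add_mono mult_left_mono v tail w0(1)) (use G in auto)
  finally show ?thesis using i(1) by (auto simp: mult.commute)
qed

text \<open>The \<open>2 * n\<close> terms form \<open>n\<close> differences with almost disjoint
  supports. A weight is tested at one coordinate per hump, hence at \<open>n = \<nu> (Suc k)\<close>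
  distinct coordinates whose parity excludes level \<open>k\<close>, and
  \<open>sum_parity_weights_le\<close> applies. With \<open>\<delta> = 1 / n\<close> the errors add
  up to at most 1.\<close>

lemma small_alternating_sum:
  fixes u :: "nat \<Rightarrow> nat \<Rightarrow> 'k::{real_normed_field, heine_borel}"
  assumes u: "\<And>m G. finite G \<Longrightarrow> (\<Sum>i\<in>G. norm (u m i)) \<le> 1"
    and c: "c < 2" "even k \<noteq> even c" and n: "n = \<nu> (Suc k)"
  obtains t :: "nat \<Rightarrow> nat" where "strict_mono t" "N \<le> t 0"
    "koethe_norm parity_weights (\<lambda>l. \<Sum>m<2 * n. (-1) ^ m * place c (u (t m)) l) \<le> 3 * (real (\<nu> k) powr (q - 1) + 1)"
proof -
  interpret weight_family parity_weights "id :: (nat \<Rightarrow> 'k) \<Rightarrow> _"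
    by unfold_locales (use parity_weights_unit_weights parity_weights_vec in auto)
  have npos: "real n > 0" using \<nu>_ge2[of "Suc k"] n by simp
  obtain t b where t: "strict_mono t" "N \<le> t 0" and b: "strict_mono b"
    \<comment> \<open>Here and in \<open>v\<close> the bound \<open>k\<close> counts humps; the
      level index \<open>k\<close> returns in the final estimate.\<close>
    and hump: "\<And>k G. finite G \<Longrightarrow> G \<inter> {b k..<b (Suc k)} = {} \<Longrightarrow>
      (\<Sum>i\<in>G. norm (u (t (2 * k)) i - u (t (2 * k + 1)) i)) \<le> 1 / real n"
    using gliding_hump[where u = u and \<delta> = "1 / real n" and N = N, OF u] npos by auto
  define v where "v k i = u (t (2 * k)) i - u (t (2 * k + 1)) i" for k i
  have v2: "(\<Sum>i\<in>G. norm (v k i)) \<le> 2" if "finite G" for k G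
  proof -
    have "(\<Sum>i\<in>G. norm (v k i)) \<le> (\<Sum>i\<in>G. norm (u (t (2 * k)) i) + norm (u (t (2 * k + 1)) i))"
      unfolding v_def by (intro sum_mono norm_triangle_ineq4)
    then show ?thesis
      using u[OF that, of "t (2 * k)"] u[OF that, of "t (2 * k + 1)"] by (simp add: sum.distrib)
  qed
  have "(\<Sum>m<2 * n. (-1) ^ m * place c (u (t m)) l) = (\<Sum>k<n. place c (v k) l)" for l
    unfolding sum_lessThan_double by (intro sum.cong) (auto simp: place_def v_def)
  moreover have "koethe_norm parity_weights (\<lambda>l. \<Sum>k<n. place c (v k) l) \<le> 3 * (real (\<nu> k) powr (q - 1) + 1)"
  proof (rule norm_le)
    fix w assume w: "w \<in> parity_weights"
    have "\<exists>i\<in>{b k..<b (Suc k)}. pairing w (place c (v k)) \<le> 2 * w (2 * i + c) + 1 / real n" for k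
      by (rule pairing_place_hump[OF w c(1) v2])
        (use hump strict_monoD[OF b, of k "Suc k"] in \<open>simp_all add: v_def\<close>)
    then obtain i where i: "\<And>k. i k \<in> {b k..<b (Suc k)}"
      and le: "\<And>k. pairing w (place c (v k)) \<le> 2 * w (2 * i k + c) + 1 / real n" by metis
    have "i k < i (Suc k)" for k using i[of k] i[of "Suc k"] by simp
    then have "strict_mono i" by (simp add: strict_mono_Suc_iff)
    then have inj: "inj_on (\<lambda>k. 2 * i k + c) {..<n}" by (auto simp: inj_on_def strict_mono_eq)
    have "pairing w (\<lambda>l. \<Sum>k<n. place c (v k) l) \<le> (\<Sum>k<n. pairing w (place c (v k)))" for n
    proof (induction n)
      case 0 show ?case by (simp add: pairing_def)
    next
      case (Suc n)
      then show ?case using pairing_add[OF w, of "\<lambda>l. \<Sum>k<n. place c (v k) l" "place c (v n)"] by simp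
    qed
    also have "(\<Sum>k<n. pairing w (place c (v k))) \<le> (\<Sum>k<n. 2 * w (2 * i k + c) + 1 / real n)"
      by (intro sum_mono le)
    also have "\<dots> = 2 * (\<Sum>k<n. w (2 * i k + c)) + 1"
      using npos by (simp add: sum.distrib sum_distrib_left)
    also have "(\<Sum>k<n. w (2 * i k + c)) = sum w ((\<lambda>k. 2 * i k + c) ` {..<n})"
      by (simp add: sum.reindex[OF inj])
    also have "\<dots> \<le> real (\<nu> k) powr (q - 1) + 1"
      by (rule sum_parity_weights_le[OF w]) (use c n card_image[OF inj] in auto)
    finally have "pairing w (\<lambda>l. \<Sum>k<n. place c (v k) l) \<le> 2 * (real (\<nu> k) powr (q - 1) + 1) + 1"
      by simp
    \<comment> \<open>The bracket is at least 1 and absorbs the accumulated error.\<close>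
    also have "\<dots> \<le> 3 * (real (\<nu> k) powr (q - 1) + 1)" by simp
    finally show "pairing w (\<lambda>l. \<Sum>k<n. place c (v k) l) \<le> 3 * (real (\<nu> k) powr (q - 1) + 1)" .
  qed
  ultimately show ?thesis using that[OF t] by simp
qed

end


section \<open>The two operators\<close>

lemma abelian_monoid_lp_space:
  assumes p: "0 < p"
  shows "abelian_monoid (lp_space p :: ('k::{real_normed_field, heine_borel}, nat \<Rightarrow> 'k) normed_module)"
proof (rule abelian_monoidI)
  fix f g :: "nat \<Rightarrow> 'k"
  assume "f \<in> carrier (lp_space p)" "g \<in> carrier (lp_space p)"
  then have f: "f 0 = 0" "summable (\<lambda>n. norm (f n) powr p)"
    and g: "g 0 = 0" "summable (\<lambda>n. norm (g n) powr p)" by (auto simp: lp_space_def)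
  \<comment> \<open>The crude bound by twice the maximum suffices for closure under
    addition.\<close>
  have le: "norm (f n + g n) powr p \<le> 2 powr p * (norm (f n) powr p + norm (g n) powr p)" for n
  proof -
    have "norm (f n + g n) \<le> 2 * max (norm (f n)) (norm (g n))"
      using norm_triangle_ineq[of "f n" "g n"] by linarith
    then have "norm (f n + g n) powr p \<le> (2 * max (norm (f n)) (norm (g n))) powr p"
      using p by (intro powr_mono2) auto
    also have "\<dots> = 2 powr p * max (norm (f n)) (norm (g n)) powr p"
      by (simp add: powr_mult)
    also have "max (norm (f n)) (norm (g n)) powr p \<le> norm (f n) powr p + norm (g n) powr p"
      by (simp add: max_def)
    finally show ?thesis by simp
  qed
  have "summable (\<lambda>n. 2 powr p * (norm (f n) powr p + norm (g n) powr p))"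
    by (intro summable_mult summable_add f g)
  then have "summable (\<lambda>n. norm (f n + g n) powr p)"
    by (rule summable_comparison_test'[where N = 0]) (use le in simp)
  then show "f \<oplus>\<^bsub>lp_space p\<^esub> g \<in> carrier (lp_space p)"
    using f g by (simp add: lp_space_def)
qed (auto simp: lp_space_def add_ac)

text \<open>The index 0 is excluded from \<open>F\<close> because the carrier demands a vanishing
  coordinate there, and the sum is evaluated inside the carrier.\<close>

lemma vnorm_lp_unit_vectors:
  fixes a :: "nat \<Rightarrow> 'k::{real_normed_field, heine_borel}"
  assumes p: "0 < p" and F: "finite F" "F \<subseteq> {1..}"
  shows "vnorm (lp_space p) (\<Oplus>\<^bsub>lp_space p\<^esub>n\<in>F. a n \<odot>\<^bsub>lp_space p\<^esub> unit_vector n) =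
    (\<Sum>n\<in>F. norm (a n) powr p) powr (1 / p)"
proof -
  let ?E = "lp_space p :: ('k, nat \<Rightarrow> 'k) normed_module"
  interpret abelian_monoid ?E by (rule abelian_monoid_lp_space[OF p])
  have car: "(\<lambda>i. if i \<in> G then a i else 0) \<in> carrier ?E" if "finite G" "G \<subseteq> {1..}" for G
    using that by (auto simp: lp_space_def intro!: summable_finite[of G])
  have smult: "a n \<odot>\<^bsub>?E\<^esub> unit_vector n = (\<lambda>i. if i \<in> {n} then a i else 0)" for n
    by (auto simp: lp_space_def unit_vector_def)
  have sum: "(\<Oplus>\<^bsub>?E\<^esub>n\<in>F. a n \<odot>\<^bsub>?E\<^esub> unit_vector n) = (\<lambda>i. if i \<in> F then a i else 0)"
    using F
  proof (induction F rule: finite_induct)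
    case empty show ?case unfolding finsum_empty by (simp add: lp_space_def)
  next
    case (insert n F)
    then have "(\<lambda>n. a n \<odot>\<^bsub>?E\<^esub> unit_vector n) \<in> insert n F \<rightarrow> carrier ?E"
      unfolding smult by (intro Pi_I car) auto
    then have "(\<Oplus>\<^bsub>?E\<^esub>n\<in>insert n F. a n \<odot>\<^bsub>?E\<^esub> unit_vector n) =
        a n \<odot>\<^bsub>?E\<^esub> unit_vector n \<oplus>\<^bsub>?E\<^esub> (\<lambda>i. if i \<in> F then a i else 0)"
      using insert by (subst finsum_insert) auto
    also have "\<dots> = (\<lambda>i. if i \<in> insert n F then a i else 0)"
      unfolding smult using insert(2) by (auto simp: lp_space_def)
    finally show ?case .
  qed
  have "(\<Sum>n. norm (if n \<in> F then a n else 0) powr p) = (\<Sum>n\<in>F. norm (a n) powr p)"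
    by (subst suminf_finite[OF F(1)]) (auto intro: sum.cong)
  then show ?thesis unfolding sum by (simp add: lp_space_def)
qed

text \<open>\<open>D.X\<close> is the domain, a copy of \<open>\<ell>\<^sub>1\<close>, and
  \<open>R.X\<close> is the range with the parity norm. Both use the same \<open>j\<close>, hence
  the same universe.\<close>

locale placement = levels p q \<nu> for p q \<nu> +
  fixes j :: "(nat \<Rightarrow> 'k::{real_normed_field, heine_borel}) \<Rightarrow> 'u"
  assumes inj_j: "inj j"
begin

sublocale D: weight_family unit_weights j
  by unfold_locales (auto simp: inj_j unit_weights_def)

sublocale R: weight_family parity_weights j
  by unfold_locales (use inj_j parity_weights_unit_weights parity_weights_vec in auto)

section \<open>The placement operators, singly and summed\<close>

lemma place_seqs:
  assumes "a \<in> koethe_seqs unit_weights" "c < 2"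
  shows "place c a \<in> koethe_seqs parity_weights"
    and "koethe_norm parity_weights (place c a) \<le> koethe_norm unit_weights a"
proof -
  have "pairing w (place c a) \<le> koethe_norm unit_weights a" if "w \<in> parity_weights" for w
    unfolding pairing_place(1)[OF that assms(2)]
    by (rule D.pairing_le_norm[OF assms(1) pairing_place(2)[OF that assms(2)]])
  then show "place c a \<in> koethe_seqs parity_weights" "koethe_norm parity_weights (place c a) \<le> koethe_norm unit_weights a"
    by (auto intro: R.seqsI R.norm_le)
qed

definition place_op :: "nat \<Rightarrow> 'u \<Rightarrow> 'u" where
  "place_op c = (\<lambda>x\<in>carrier D.X. j (place c (the_inv j x)))"

lemma place_op_eq: "a \<in> koethe_seqs unit_weights \<Longrightarrow> place_op c (j a) = j (place c a)"
  by (simp add: place_op_def)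

lemma place_op_operator:
  assumes c: "c < 2" shows "place_op c \<in> operators D.X R.X"
  unfolding operators_def mem_Collect_eq
proof (intro conjI ballI allI)
  show "place_op c \<in> carrier D.X \<rightarrow>\<^sub>E carrier R.X"
    by (auto simp: place_op_def place_seqs(1)[OF _ c])
  have add: "place c (\<lambda>i. a i + b i) = (\<lambda>i. place c a i + place c b i)"
    and diff: "place c (\<lambda>i. a i - b i) = (\<lambda>i. place c a i - place c b i)"
    and scale: "place c (\<lambda>i. d * a i) = (\<lambda>i. d * place c a i)" for a b :: "nat \<Rightarrow> 'k" and d
    by (auto simp: place_def)
  show "place_op c (x \<oplus>\<^bsub>D.X\<^esub> y) = place_op c x \<oplus>\<^bsub>R.X\<^esub> place_op c y"
    if "x \<in> carrier D.X" "y \<in> carrier D.X" for x y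
    using that by (auto simp: place_op_eq D.seqs_add(1) add)
  show "place_op c (d \<odot>\<^bsub>D.X\<^esub> x) = d \<odot>\<^bsub>R.X\<^esub> place_op c x" if "x \<in> carrier D.X" for x d
    using that by (auto simp: place_op_eq D.seqs_scale(1) scale)
  have "ndist R.X (place_op c x) (place_op c y) \<le> ndist D.X x y"
    if xy: "x \<in> carrier D.X" "y \<in> carrier D.X" for x y
  proof -
    obtain a b where ab: "x = j a" "y = j b" "a \<in> koethe_seqs unit_weights" "b \<in> koethe_seqs unit_weights"
      using xy by auto
    then show ?thesis
      using place_seqs(2)[OF D.seqs_diff[OF ab(3,4)] c] by (simp add: place_op_eq place_seqs(1) c diff)
  qed
  then show "continuous_map (ntopology D.X) (ntopology R.X) (place_op c)"
    unfolding D.M.metric_continuous_map[OF R.Metric_X]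
    using \<open>place_op c \<in> carrier D.X \<rightarrow>\<^sub>E carrier R.X\<close> by (blast intro: le_less_trans)
qed

lemma l1_norm_bound:
  assumes "a \<in> koethe_seqs unit_weights" "finite G"
  shows "(\<Sum>i\<in>G. norm (a i)) \<le> koethe_norm unit_weights a"
proof -
  have "(\<lambda>i. if i \<in> G then 1 else 0) \<in> unit_weights"
    using assms(2) by (simp add: unit_weights_def)
  from D.pairing_le_norm[OF assms(1) this] show ?thesis
    using pairing_eq_sum[OF assms(2), of "\<lambda>i. if i \<in> G then 1 else 0" a] by simp
qed

text \<open>Domination with constant \<open>C\<close> is tested on \<open>2 * n\<close> far-out
  vectors with alternating signs. In \<open>\<ell>\<^sub>p\<close> their combination has norm
  \<open>(2 * n) powr (1 / p)\<close>, while the image is bounded by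
  \<open>small_alternating_sum\<close>. For \<open>k > 3 * C\<close> the growth condition
  contradicts this.\<close>

lemma place_op_not_dominates:
  assumes c: "c < 2" and x: "\<And>n. n \<ge> 1 \<Longrightarrow> x n \<in> carrier D.X" "normalized D.X x"
    and L: "ladder_system L" "{..<\<xi>} \<noteq> {}"
  shows "\<not> dominates (schreier_family L \<xi>) R.X (\<lambda>n. place_op c (x n))
    (lp_space p :: ('k, nat \<Rightarrow> 'k) normed_module) unit_vector"
proof
  let ?E = "lp_space p :: ('k, nat \<Rightarrow> 'k) normed_module"
  assume "dominates (schreier_family L \<xi>) R.X (\<lambda>n. place_op c (x n)) ?E unit_vector"
  then obtain C :: real where C: "C \<ge> 1" and dom: "\<And>a F. finite {n. a n \<noteq> 0} \<Longrightarrow> F \<in> schreier_family L \<xi> \<Longrightarrow>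
      vnorm ?E (\<Oplus>\<^bsub>?E\<^esub>n\<in>F. a n \<odot>\<^bsub>?E\<^esub> unit_vector n) \<le>
      C * vnorm R.X (\<Oplus>\<^bsub>R.X\<^esub>n\<in>F. a n \<odot>\<^bsub>R.X\<^esub> place_op c (x n))"
    unfolding dominates_def by blast
  \<comment> \<open>Nothing is known about \<open>x 0\<close>, so it is replaced by 0 and the norm
    bound holds for all indices.\<close>
  define u where "u n = (if n = 0 then (\<lambda>_. 0) else the_inv j (x n))" for n
  have u: "u n \<in> koethe_seqs unit_weights" for n
    using x(1)[of n] D.seqs_zero by (auto simp: u_def)
  have xu: "x n = j (u n)" if "n \<ge> 1" for n
    using x(1)[OF that] that by (auto simp: u_def)
  have u1: "(\<Sum>i\<in>G. norm (u m i)) \<le> 1" if "finite G" for m G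
  proof (cases "m = 0")
    case False
    then have "vnorm D.X (x m) = 1" using x(2) by (simp add: normalized_def)
    then have "koethe_norm unit_weights (u m) = 1" using xu[of m] False by simp
    then show ?thesis using l1_norm_bound[OF u that] by metis
  qed (simp add: u_def)
  \<comment> \<open>The summand \<open>3 - c\<close> is positive and has the parity opposite to
    \<open>c\<close>, so level \<open>k\<close> is one that the chosen coordinates lack.\<close>
  define k where "k = 2 * nat \<lceil>3 * C\<rceil> + (3 - c)"
  have kc: "even k \<noteq> even c" using c by (auto simp: k_def less_2_cases_iff)
  have "nat \<lceil>3 * C\<rceil> < k" using c by (simp add: k_def)
  then have k: "3 * C < real k" using real_nat_ceiling_ge[of "3 * C"] by linarith
  define n where "n = \<nu> (Suc k)"
  have n: "real n > 0" using \<nu>_ge2[of "Suc k"] by (simp add: n_def)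
  obtain N where N: "N \<ge> 1"
    "\<And>F. finite F \<Longrightarrow> card F \<le> 2 * n \<Longrightarrow> F \<subseteq> {N..} \<Longrightarrow> F \<in> schreier_family L \<xi>"
    using schreier_family_large[OF L, of "2 * n"] by blast
  obtain t :: "nat \<Rightarrow> nat" where t: "strict_mono t" "N \<le> t 0" and
    small: "koethe_norm parity_weights (\<lambda>l. \<Sum>m<2 * n. (-1) ^ m * place c (u (t m)) l) \<le> 3 * (real (\<nu> k) powr (q - 1) + 1)"
    using small_alternating_sum[where u = u and N = N, OF u1 c kc n_def] by blast
  have inj_t: "inj t" using t(1) by (rule strict_mono_imp_inj_on)
  define F where "F = t ` {..<2 * n}"
  \<comment> \<open>The sign follows the position within the subsequence:
    \<open>a (t m) = (-1) ^ m\<close>.\<close>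
  define a :: "nat \<Rightarrow> 'k" where "a m = (if m \<in> F then (-1) ^ the_inv t m else 0)" for m
  have card_F: "card F = 2 * n" unfolding F_def by (simp add: card_image inj_on_subset[OF inj_t])
  have "N \<le> t m" for m using t(2) strict_mono_mono[OF t(1), THEN monoD, of 0 m] by simp
  then have F: "finite F" "F \<subseteq> {N..}" "F \<subseteq> {1..}" using N(1) by (auto simp: F_def intro: order_trans)
  have "(\<Oplus>\<^bsub>R.X\<^esub>m\<in>F. a m \<odot>\<^bsub>R.X\<^esub> place_op c (x m)) = (\<Oplus>\<^bsub>R.X\<^esub>m\<in>F. a m \<odot>\<^bsub>R.X\<^esub> j (place c (u m)))"
    using F(3) R.seqs_scale(1)[OF place_seqs(1)[OF u c]]
    by (intro R.X.finsum_cong' refl) (auto simp: xu place_op_eq u)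
  also have "\<dots> = j (\<lambda>l. \<Sum>m\<in>F. a m * place c (u m) l)"
    by (rule R.finsum_smult_X) (rule place_seqs(1)[OF u c])
  also have "(\<lambda>l. \<Sum>m\<in>F. a m * place c (u m) l) = (\<lambda>l. \<Sum>m<2 * n. (-1) ^ m * place c (u (t m)) l)"
    unfolding F_def
    by (subst sum.reindex[OF inj_on_subset[OF inj_t]]) (auto simp: a_def F_def the_inv_f_f[OF inj_t])
  finally have rhs: "(\<Oplus>\<^bsub>R.X\<^esub>m\<in>F. a m \<odot>\<^bsub>R.X\<^esub> place_op c (x m)) =
      j (\<lambda>l. \<Sum>m<2 * n. (-1) ^ m * place c (u (t m)) l)" .
  have "(\<Sum>m\<in>F. norm (a m) powr p) = real (2 * n)"
    using card_F by (simp add: a_def norm_power)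
  then have "real (2 * n) powr (1 / p) = vnorm ?E (\<Oplus>\<^bsub>?E\<^esub>m\<in>F. a m \<odot>\<^bsub>?E\<^esub> unit_vector m)"
    using p F by (subst vnorm_lp_unit_vectors) auto
  also have "\<dots> \<le> C * vnorm R.X (\<Oplus>\<^bsub>R.X\<^esub>m\<in>F. a m \<odot>\<^bsub>R.X\<^esub> place_op c (x m))"
    by (rule dom) (use F N(2) card_F in \<open>auto simp: a_def\<close>)
  also have "\<dots> \<le> C * (3 * (real (\<nu> k) powr (q - 1) + 1))"
    unfolding rhs R.vnorm_X using small C by (intro mult_left_mono) auto
  also have "\<dots> = (3 * C) * (real (\<nu> k) powr (q - 1) + 1)" by simp
  also have "\<dots> < real k * (real (\<nu> k) powr (q - 1) + 1)"
    using k by (intro mult_strict_right_mono add_nonneg_pos) auto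
  also have "\<dots> \<le> real n powr (1 / p)" unfolding n_def by (rule \<nu>_growth)
  also have "\<dots> \<le> real (2 * n) powr (1 / p)" using p by (intro powr_mono2) auto
  finally show False by simp
qed

lemma place_op_in_WS:
  assumes "c < 2" "ladder_system L" "{..<\<xi>} \<noteq> {}"
  shows "(D.X, R.X, place_op c) \<in> WS (lp_space p :: ('k, nat \<Rightarrow> 'k) normed_module) unit_vector L \<xi>"
  unfolding WS_def
  using D.banach_X R.banach_X place_op_operator[OF assms(1)] place_op_not_dominates[OF assms(1) _ _ assms(2,3)]
  by (simp add: basic_sequence_def)

text \<open>The sum of the operators repeats every coordinate twice, so
  \<open>lp_norm_le_doubled\<close> shows that the images of the unit vectors of
  \<open>\<ell>\<^sub>1\<close> dominate the basis of \<open>\<ell>\<^sub>p\<close> with constant 1,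
  on every finite set of positive indices.\<close>

lemma sum_place_op_not_in_WS:
  "(D.X, R.X, op_add D.X R.X (place_op 0) (place_op 1)) \<notin>
    WS (lp_space p :: ('k, nat \<Rightarrow> 'k) normed_module) unit_vector L \<xi>"
proof -
  let ?E = "lp_space p :: ('k, nat \<Rightarrow> 'k) normed_module"
  let ?x = "\<lambda>n. j (unit_vector n)"
  let ?T = "op_add D.X R.X (place_op 0) (place_op 1)"
  have double: "(\<lambda>l. b (l div 2)) \<in> koethe_seqs parity_weights" if "finite F" "\<And>i. i \<notin> F \<Longrightarrow> b i = 0" for b :: "nat \<Rightarrow> 'k" and F
  proof -
    obtain M where "F \<subseteq> {..<M}" using \<open>finite F\<close> finite_nat_iff_bounded by blast
    then have "b (l div 2) = 0" if "l \<notin> {..<2 * M}" for l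
    proof -
      have "M \<le> l div 2" using that by (simp add: not_less less_eq_div_iff_mult_less_eq)
      then have "l div 2 \<notin> F" using \<open>F \<subseteq> {..<M}\<close> by (meson lessThan_iff not_less subsetD)
      then show ?thesis by fact
    qed
    then show ?thesis by (rule R.seqs_finite_support[OF finite_lessThan])
  qed
  have "(\<lambda>l. place 0 a l + place 1 a l) = (\<lambda>l. a (l div 2))" for a :: "nat \<Rightarrow> 'k"
    by (auto simp: place_def)
  then have T: "?T (?x n) = j (\<lambda>l. unit_vector n (l div 2))" for n
    using D.unit_vector_seqs[of n] by (simp add: op_add_def place_op_eq del: One_nat_def)
  have "vnorm ?E (\<Oplus>\<^bsub>?E\<^esub>n\<in>F. a n \<odot>\<^bsub>?E\<^esub> unit_vector n) \<le>
      1 * vnorm R.X (\<Oplus>\<^bsub>R.X\<^esub>n\<in>F. a n \<odot>\<^bsub>R.X\<^esub> ?T (?x n))" if "F \<in> schreier_family L \<xi>" for a F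
  proof -
    have F: "finite F" "F \<subseteq> {1..}" using schreier_family_finite_subset[OF that] by auto
    define b where "b i = (if i \<in> F then a i else 0)" for i
    obtain M where M: "F \<subseteq> {..<M}" using F(1) finite_nat_iff_bounded by blast
    have "(\<Oplus>\<^bsub>R.X\<^esub>n\<in>F. a n \<odot>\<^bsub>R.X\<^esub> ?T (?x n)) = j (\<lambda>l. \<Sum>n\<in>F. a n * unit_vector n (l div 2))"
      unfolding T by (rule R.finsum_smult_X) (rule double[of "{_}"], auto simp: unit_vector_def)
    also have "\<dots> = j (\<lambda>l. b (l div 2))" using D.unit_vector_sum[OF F(1), of a] by (simp add: b_def)
    finally have rhs: "(\<Oplus>\<^bsub>R.X\<^esub>n\<in>F. a n \<odot>\<^bsub>R.X\<^esub> ?T (?x n)) = j (\<lambda>l. b (l div 2))" .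
    have "(\<Sum>n\<in>F. norm (a n) powr p) = (\<Sum>i<M. norm (b i) powr p)"
      using M by (intro sum.mono_neutral_cong_left) (auto simp: b_def)
    then have "vnorm ?E (\<Oplus>\<^bsub>?E\<^esub>n\<in>F. a n \<odot>\<^bsub>?E\<^esub> unit_vector n) = (\<Sum>i<M. norm (b i) powr p) powr (1 / p)"
      using p F by (subst vnorm_lp_unit_vectors) auto
    also have "\<dots> \<le> koethe_norm parity_weights (\<lambda>l. b (l div 2))"
      by (rule lp_norm_le_doubled[OF double[OF F(1)]]) (simp add: b_def)
    finally show ?thesis unfolding rhs by simp
  qed
  then have "dominates (schreier_family L \<xi>) R.X (\<lambda>n. ?T (?x n)) ?E unit_vector"
    unfolding dominates_def by (intro exI[of _ 1]) auto
  moreover have "normalized D.X ?x" by (simp add: normalized_def D.norm_unit_vector)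
  ultimately show ?thesis using D.basic_unit_vectors unfolding WS_def by auto
qed

end

theorem theorem2p10:
  fixes p :: real
    and \<xi> :: "'o::wellorder"
    and L :: "'o \<Rightarrow> nat \<Rightarrow> 'o"
    and j :: "(nat \<Rightarrow> 'k::{real_normed_field, heine_borel}) \<Rightarrow> 'u"
  assumes universe: "inj j"
    and p: "1 < p"
    and ladder: "ladder_system L"
    and xi_ge_1: "{..<\<xi>} \<noteq> {}"
    and xi_le_omega1: "\<forall>\<eta><\<xi>. countable {..<\<eta>}"
  shows "\<not> closed_under_addition
            (WS (lp_space p :: ('k, nat \<Rightarrow> 'k) normed_module) unit_vector L \<xi> :: ('k, 'u) op_class)
       \<and> \<not> operator_ideal
            (WS (lp_space p :: ('k, nat \<Rightarrow> 'k) normed_module) unit_vector L \<xi> :: ('k, 'u) op_class)"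
proof -
  let ?J = "WS (lp_space p :: ('k, nat \<Rightarrow> 'k) normed_module) unit_vector L \<xi> :: ('k, 'u) op_class"
  \<comment> \<open>The exponent conjugate to \<open>p\<close>.\<close>
  define q where "q = p / (p - 1)"
  have q: "1 < q" "1 / p + 1 / q = 1" using p by (simp_all add: q_def field_simps)
  obtain \<nu> :: "nat \<Rightarrow> nat" where \<nu>: "\<nu> 0 = 2" "strict_mono \<nu>"
    "\<And>k. real k * (real (\<nu> k) powr (q - 1) + 1) \<le> real (\<nu> (Suc k)) powr (1 / p)"
    using fast_growing_sequence[of "1 / p" "\<lambda>k m. real k * (real m powr (q - 1) + 1)"] p by auto
  interpret placement p q \<nu> j
    by unfold_locales (use p q \<nu> universe in auto)
  have "\<not> closed_under_addition ?J"
  proof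
    assume "closed_under_addition ?J"
    then have "op_add D.X R.X (place_op 0) (place_op 1) \<in> component ?J D.X R.X"
      using D.banach_X R.banach_X place_op_in_WS[OF _ ladder xi_ge_1]
      unfolding closed_under_addition_def component_def by simp
    then show False using sum_place_op_not_in_WS unfolding component_def by blast
  qed
  \<comment> \<open>Additivity of the components is one clause of being an ideal, so the second
    claim follows from the first.\<close>
  moreover have "closed_under_addition ?J" if "operator_ideal ?J"
    using that unfolding operator_ideal_def closed_under_addition_def by blast
  ultimately show ?thesis by blast
qed

end
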